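(* Let $M$ be a quasi-discrete module with the (finite) exchange property. Then $M$ satisfies the perspective-Schröder-Bernstein (PSB) property.
   Context: Rings are associative with unity and modules are unital. A module $M$ is quasi-discrete if it satisfies: $(D_1)$ for every submodule $A$ of $M$ there is a decomposition $M=M_1\oplus M_2$ with $M_1\subseteq A$ and $A\cap M_2$ small (superfluous) in $M$; and $(D_3)$ if $M_1,M_2$ are direct summands of $M$ with $M_1+M_2=M$, then $M_1\cap M_2$ is a direct summand of $M$. A module $M$ has the (full) exchange property if for every module $X$ and all decompositions $X=M'\oplus N=\bigoplus_{i\in I}X_i$ with $M'\cong M$, there exist submodules $X_i'\subseteq X_i$ with $X=M'\oplus\bigoplus_{i\in I}X_i'$; it has the finite exchange property if this holds for all finite index sets $I$. For quasi-discrete modules the finite exchange property is known to imply the full exchange property, so "(finite)" may be read as the finite exchange property. Write $A\subseteq^{\oplus}M$ if $A$ is a direct summand of $M$. Two direct summands $A,B$ of $M$ are perspective, written $A\sim_p B$, if there is a submodule $C$ with $M=A\oplus C=B\oplus C$. $M$ has the PSB-property if for any direct summands $A,B$ of $M$: whenever $A\sim_p B'$ for some $B'\subseteq^{\oplus}B$ and $B\sim_p A'$ for some $A'\subseteq^{\oplus}A$ (perspectivity taken in $M$), then $A\sim_p B$. *)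

theory Defs
  imports "HOL-Algebra.Module" "HOL-Algebra.AbelCoset"
begin

text \<open>
  The locale \<^locale>\<open>module\<close> of HOL-Algebra requires a commutative ring of scalars.  The
  following is the same notion over an arbitrary associative ring with unity.  Right modules
  over a ring are left modules over its opposite ring, so fixing a side loses nothing when the
  ring is arbitrary.  The locale \<^locale>\<open>submodule\<close> does not mention commutativity and is
  used unchanged.
\<close>

locale left_module = R?: ring R + M?: abelian_group M
  for R :: "('a, 'r) ring_scheme" (structure)
    and M :: "('a, 'b, 'm) module_scheme" (structure) +
  assumes smult_closed [simp, intro]:
      "\<lbrakk>a \<in> carrier R; x \<in> carrier M\<rbrakk> \<Longrightarrow> a \<odot>\<^bsub>M\<^esub> x \<in> carrier M"
    and smult_l_distr:
      "\<lbrakk>a \<in> carrier R; b \<in> carrier R; x \<in> carrier M\<rbrakk> \<Longrightarrow>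
        (a \<oplus>\<^bsub>R\<^esub> b) \<odot>\<^bsub>M\<^esub> x = a \<odot>\<^bsub>M\<^esub> x \<oplus>\<^bsub>M\<^esub> b \<odot>\<^bsub>M\<^esub> x"
    and smult_r_distr:
      "\<lbrakk>a \<in> carrier R; x \<in> carrier M; y \<in> carrier M\<rbrakk> \<Longrightarrow>
        a \<odot>\<^bsub>M\<^esub> (x \<oplus>\<^bsub>M\<^esub> y) = a \<odot>\<^bsub>M\<^esub> x \<oplus>\<^bsub>M\<^esub> a \<odot>\<^bsub>M\<^esub> y"
    and smult_assoc1:
      "\<lbrakk>a \<in> carrier R; b \<in> carrier R; x \<in> carrier M\<rbrakk> \<Longrightarrow>
        (a \<otimes>\<^bsub>R\<^esub> b) \<odot>\<^bsub>M\<^esub> x = a \<odot>\<^bsub>M\<^esub> (b \<odot>\<^bsub>M\<^esub> x)"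
    and smult_one [simp]:
      "x \<in> carrier M \<Longrightarrow> \<one>\<^bsub>R\<^esub> \<odot>\<^bsub>M\<^esub> x = x"

definition module_iso ::
  "('a, 'r) ring_scheme \<Rightarrow> ('a, 'b, 'm) module_scheme \<Rightarrow> ('a, 'c, 'n) module_scheme \<Rightarrow> ('b \<Rightarrow> 'c) set"
  where "module_iso R M N =
    {h. bij_betw h (carrier M) (carrier N) \<and>
        (\<forall>x\<in>carrier M. \<forall>y\<in>carrier M. h (x \<oplus>\<^bsub>M\<^esub> y) = h x \<oplus>\<^bsub>N\<^esub> h y) \<and>
        (\<forall>a\<in>carrier R. \<forall>x\<in>carrier M. h (a \<odot>\<^bsub>M\<^esub> x) = a \<odot>\<^bsub>N\<^esub> h x)}"

definition direct_sum ::
  "('a, 'r) ring_scheme \<Rightarrow> ('a, 'b, 'm) module_scheme \<Rightarrow> 'b set \<Rightarrow> 'b set \<Rightarrow> bool"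
  where "direct_sum R M A B \<longleftrightarrow>
    submodule A R M \<and> submodule B R M \<and>
    A <+>\<^bsub>M\<^esub> B = carrier M \<and> A \<inter> B = {\<zero>\<^bsub>M\<^esub>}"

text \<open>Only for finite \<open>I\<close>, where \<^const>\<open>finsum\<close> is a genuine sum.\<close>

definition direct_sum_family ::
  "('a, 'r) ring_scheme \<Rightarrow> ('a, 'b, 'm) module_scheme \<Rightarrow> 'i set \<Rightarrow> ('i \<Rightarrow> 'b set) \<Rightarrow> bool"
  where "direct_sum_family R X I S \<longleftrightarrow>
    (\<forall>i\<in>I. submodule (S i) R X) \<and>
    (\<forall>x\<in>carrier X. \<exists>!f. f \<in> (\<Pi>\<^sub>E i\<in>I. S i) \<and> finsum X f I = x)"

definition direct_summand ::
  "('a, 'r) ring_scheme \<Rightarrow> ('a, 'b, 'm) module_scheme \<Rightarrow> 'b set \<Rightarrow> bool"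
  where "direct_summand R M A \<longleftrightarrow> (\<exists>B. direct_sum R M A B)"

definition small_submodule ::
  "('a, 'r) ring_scheme \<Rightarrow> ('a, 'b, 'm) module_scheme \<Rightarrow> 'b set \<Rightarrow> bool"
  where "small_submodule R M S \<longleftrightarrow>
    submodule S R M \<and>
    (\<forall>T. submodule T R M \<and> S <+>\<^bsub>M\<^esub> T = carrier M \<longrightarrow> T = carrier M)"

definition cond_D1 ::
  "('a, 'r) ring_scheme \<Rightarrow> ('a, 'b, 'm) module_scheme \<Rightarrow> bool"
  where "cond_D1 R M \<longleftrightarrow>
    (\<forall>A. submodule A R M \<longrightarrow>
      (\<exists>M1 M2. direct_sum R M M1 M2 \<and> M1 \<subseteq> A \<and> small_submodule R M (A \<inter> M2)))"

definition cond_D3 ::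
  "('a, 'r) ring_scheme \<Rightarrow> ('a, 'b, 'm) module_scheme \<Rightarrow> bool"
  where "cond_D3 R M \<longleftrightarrow>
    (\<forall>M1 M2. direct_summand R M M1 \<and> direct_summand R M M2 \<and> M1 <+>\<^bsub>M\<^esub> M2 = carrier M \<longrightarrow>
      direct_summand R M (M1 \<inter> M2))"

definition quasi_discrete ::
  "('a, 'r) ring_scheme \<Rightarrow> ('a, 'b, 'm) module_scheme \<Rightarrow> bool"
  where "quasi_discrete R M \<longleftrightarrow> cond_D1 R M \<and> cond_D3 R M"

text \<open>
  The exchange property quantifies over all modules \<open>X\<close>; the type argument is the universe
  from which the elements of \<open>X\<close> are drawn.  The theorem \<open>finite_exchange_any_universe\<close> below
  shows that \<^typ>\<open>nat \<Rightarrow> 'b\<close>, where \<^typ>\<open>'b\<close> is the type of the elements of \<open>M\<close>, is large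
  enough: the property in that universe implies it in every other one.  (Divide \<open>X\<close> by the sum
  of the \<open>S i \<inter> N\<close>; the quotient embeds in a finite power of \<open>M\<close>.)  Finite index sets are
  taken as sets of natural numbers.  In the conclusion the index \<^term>\<open>None\<close> carries the
  summand \<open>M'\<close> and \<^term>\<open>Some i\<close> the summand \<open>S' i\<close>.
\<close>

definition finite_exchange ::
  "'x itself \<Rightarrow> ('a, 'r) ring_scheme \<Rightarrow> ('a, 'b, 'm) module_scheme \<Rightarrow> bool"
  where "finite_exchange U R M \<longleftrightarrow>
    (\<forall>(X :: ('a, 'x) module) M' N (I :: nat set) S.
      left_module R X \<and> direct_sum R X M' N \<and>
      (\<exists>h. h \<in> module_iso R M (X\<lparr>carrier := M'\<rparr>)) \<and>
      finite I \<and> direct_sum_family R X I S \<longrightarrow>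
      (\<exists>S'. (\<forall>i\<in>I. S' i \<subseteq> S i) \<and>
        direct_sum_family R X (insert None (Some ` I)) (case_option M' S')))"

definition perspective ::
  "('a, 'r) ring_scheme \<Rightarrow> ('a, 'b, 'm) module_scheme \<Rightarrow> 'b set \<Rightarrow> 'b set \<Rightarrow> bool"
  where "perspective R M A B \<longleftrightarrow> (\<exists>C. direct_sum R M A C \<and> direct_sum R M B C)"

definition PSB_property ::
  "('a, 'r) ring_scheme \<Rightarrow> ('a, 'b, 'm) module_scheme \<Rightarrow> bool"
  where "PSB_property R M \<longleftrightarrow>
    (\<forall>A B. direct_summand R M A \<and> direct_summand R M B \<and>
      (\<exists>B'. direct_summand R (M\<lparr>carrier := B\<rparr>) B' \<and> perspective R M A B') \<and>
      (\<exists>A'. direct_summand R (M\<lparr>carrier := A\<rparr>) A' \<and> perspective R M B A') \<longrightarrow>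
      perspective R M A B)"


lemma ex1_unique: "\<exists>!x. P x \<Longrightarrow> P a \<Longrightarrow> P b \<Longrightarrow> a = b"
  by blast

lemma (in left_module) smult_r_zero:
  assumes "a \<in> carrier R" shows "a \<odot>\<^bsub>M\<^esub> \<zero>\<^bsub>M\<^esub> = \<zero>\<^bsub>M\<^esub>"
proof -
  have "a \<odot>\<^bsub>M\<^esub> \<zero>\<^bsub>M\<^esub> \<oplus>\<^bsub>M\<^esub> a \<odot>\<^bsub>M\<^esub> \<zero>\<^bsub>M\<^esub> = a \<odot>\<^bsub>M\<^esub> \<zero>\<^bsub>M\<^esub>"
    using smult_r_distr[OF assms M.zero_closed M.zero_closed] by simp
  then show ?thesis
    using assms by (metis M.add.r_cancel_one' M.zero_closed smult_closed)
qed

context left_module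
begin

lemma submod_zero: "submodule H R M \<Longrightarrow> \<zero>\<^bsub>M\<^esub> \<in> H"
  by (metis monoid.simps(2) submodule.axioms(1) subgroup.one_closed)

lemma submod_sub: "submodule H R M \<Longrightarrow> H \<subseteq> carrier M"
  by (metis partial_object.simps(1) submodule.axioms(1) subgroup.subset)

lemma submod_add: "submodule H R M \<Longrightarrow> x \<in> H \<Longrightarrow> y \<in> H \<Longrightarrow> x \<oplus>\<^bsub>M\<^esub> y \<in> H"
  by (metis monoid.simps(1) submodule.axioms(1) subgroup.m_closed)

lemma submod_neg: "submodule H R M \<Longrightarrow> x \<in> H \<Longrightarrow> \<ominus>\<^bsub>M\<^esub> x \<in> H"
  by (metis a_inv_def submodule.axioms(1) subgroup.m_inv_closed)

lemma submod_diff: "submodule H R M \<Longrightarrow> x \<in> H \<Longrightarrow> y \<in> H \<Longrightarrow> x \<ominus>\<^bsub>M\<^esub> y \<in> H"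
  by (simp add: a_minus_def submod_add submod_neg)

lemma submod_smult: "submodule H R M \<Longrightarrow> a \<in> carrier R \<Longrightarrow> x \<in> H \<Longrightarrow> a \<odot>\<^bsub>M\<^esub> x \<in> H"
  by (rule submodule.smult_closed)

lemma submod_sum:
  assumes "submodule H R M" "finite I" "\<And>i. i \<in> I \<Longrightarrow> f i \<in> H"
  shows "finsum M f I \<in> H"
  using assms(2,3)
proof (induction I)
  case empty
  then show ?case using submod_zero[OF assms(1)] by simp
next
  case (insert i I)
  then have "f \<in> I \<rightarrow> carrier M" "f i \<in> carrier M"
    using submod_sub[OF assms(1)] by auto
  then show ?case using insert submod_add[OF assms(1)] by simp
qed

lemma submodI:
  assumes "H \<subseteq> carrier M" "\<zero>\<^bsub>M\<^esub> \<in> H"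
    "\<And>x y. x \<in> H \<Longrightarrow> y \<in> H \<Longrightarrow> x \<oplus>\<^bsub>M\<^esub> y \<in> H" "\<And>x. x \<in> H \<Longrightarrow> \<ominus>\<^bsub>M\<^esub> x \<in> H"
    "\<And>a x. a \<in> carrier R \<Longrightarrow> x \<in> H \<Longrightarrow> a \<odot>\<^bsub>M\<^esub> x \<in> H"
  shows "submodule H R M"
  using assms by (intro submodule.intro subgroup.intro submodule_axioms.intro) (auto simp: a_inv_def)

lemma eq_if_diff_zero:
  assumes "x \<in> carrier M" "y \<in> carrier M" "x \<ominus>\<^bsub>M\<^esub> y = \<zero>\<^bsub>M\<^esub>"
  shows "x = y"
proof -
  have "x = x \<oplus>\<^bsub>M\<^esub> (\<ominus>\<^bsub>M\<^esub> y \<oplus>\<^bsub>M\<^esub> y)" using assms by (simp add: M.l_neg)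
  also have "\<dots> = (x \<ominus>\<^bsub>M\<^esub> y) \<oplus>\<^bsub>M\<^esub> y"
    using assms M.a_assoc[of x "\<ominus>\<^bsub>M\<^esub> y" y] by (simp add: a_minus_def)
  finally show ?thesis using assms by simp
qed

lemma add_diff_cancel:
  assumes "x \<in> carrier M" "y \<in> carrier M" shows "y \<oplus>\<^bsub>M\<^esub> (x \<ominus>\<^bsub>M\<^esub> y) = x"
proof -
  have "x \<ominus>\<^bsub>M\<^esub> y \<oplus>\<^bsub>M\<^esub> y = x"
    using assms by (simp add: a_minus_def M.a_assoc M.l_neg)
  then show ?thesis using assms M.a_comm[of y "x \<ominus>\<^bsub>M\<^esub> y"] by simp
qed

lemma finsum_minus:
  assumes "finite I" "f \<in> I \<rightarrow> carrier M"
  shows "finsum M (\<lambda>i. \<ominus>\<^bsub>M\<^esub> f i) I = \<ominus>\<^bsub>M\<^esub> finsum M f I"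
  using assms
proof (induction I)
  case empty
  then show ?case by (simp add: a_inv_def)
next
  case (insert i I)
  then have "f \<in> I \<rightarrow> carrier M" "f i \<in> carrier M" "(\<lambda>i. \<ominus>\<^bsub>M\<^esub> f i) \<in> I \<rightarrow> carrier M" by auto
  then show ?case using insert by (simp add: M.minus_add)
qed

lemma direct_sum_family_iff:
  assumes "finite I" "\<And>i. i \<in> I \<Longrightarrow> submodule (S i) R M"
  shows "direct_sum_family R M I S \<longleftrightarrow>
    (\<forall>x\<in>carrier M. \<exists>f. (\<forall>i\<in>I. f i \<in> S i) \<and> finsum M f I = x) \<and>
    (\<forall>f. (\<forall>i\<in>I. f i \<in> S i) \<and> finsum M f I = \<zero>\<^bsub>M\<^esub> \<longrightarrow> (\<forall>i\<in>I. f i = \<zero>\<^bsub>M\<^esub>))"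
    (is "_ \<longleftrightarrow> ?E \<and> ?U")
proof (intro iffI conjI)
  have sub: "S i \<subseteq> carrier M" if "i \<in> I" for i
    using submod_sub assms(2) that by blast
  have restr: "finsum M (restrict f I) I = finsum M f I" if "\<forall>i\<in>I. f i \<in> S i" for f
    by (rule M.finsum_cong') (use that sub in auto)
  assume D: "direct_sum_family R M I S"
  have D1: "\<exists>!f. f \<in> (\<Pi>\<^sub>E i\<in>I. S i) \<and> finsum M f I = x" if "x \<in> carrier M" for x
    by (rule D[unfolded direct_sum_family_def, THEN conjunct2, rule_format, OF that])
  show ?E
  proof
    fix x assume "x \<in> carrier M"
    then obtain f where "f \<in> (\<Pi>\<^sub>E i\<in>I. S i)" "finsum M f I = x"
      using D1 ex1_implies_ex by blast
    then have "(\<forall>i\<in>I. f i \<in> S i) \<and> finsum M f I = x" by blast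
    then show "\<exists>f. (\<forall>i\<in>I. f i \<in> S i) \<and> finsum M f I = x" by (rule exI[of _ f])
  qed
  show ?U
  proof (intro allI impI ballI)
    fix f i assume f: "(\<forall>i\<in>I. f i \<in> S i) \<and> finsum M f I = \<zero>\<^bsub>M\<^esub>" and i: "i \<in> I"
    have D0: "\<exists>!f. f \<in> (\<Pi>\<^sub>E i\<in>I. S i) \<and> finsum M f I = \<zero>\<^bsub>M\<^esub>"
      by (rule D1[OF M.zero_closed])
    have "restrict f I \<in> (\<Pi>\<^sub>E i\<in>I. S i) \<and> finsum M (restrict f I) I = \<zero>\<^bsub>M\<^esub>"
      using f restr[of f] by simp
    moreover have "(\<lambda>i\<in>I. \<zero>\<^bsub>M\<^esub>) \<in> (\<Pi>\<^sub>E i\<in>I. S i) \<and>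
        finsum M (\<lambda>i\<in>I. \<zero>\<^bsub>M\<^esub>) I = \<zero>\<^bsub>M\<^esub>"
      using restr[of "\<lambda>_. \<zero>\<^bsub>M\<^esub>"] submod_zero[OF assms(2)] by simp
    ultimately have "restrict f I = (\<lambda>i\<in>I. \<zero>\<^bsub>M\<^esub>)"
      by (rule ex1_unique[OF D0])
    then show "f i = \<zero>\<^bsub>M\<^esub>" using i by (metis restrict_apply')
  qed
next
  have sub: "S i \<subseteq> carrier M" if "i \<in> I" for i
    using submod_sub assms(2) that by blast
  have restr: "finsum M (restrict f I) I = finsum M f I" if "\<forall>i\<in>I. f i \<in> S i" for f
    by (rule M.finsum_cong') (use that sub in auto)
  assume EU: "?E \<and> ?U"
  have E: "\<exists>f. (\<forall>i\<in>I. f i \<in> S i) \<and> finsum M f I = x" if "x \<in> carrier M" for x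
    by (rule EU[THEN conjunct1, rule_format, OF that])
  have U: "f i = \<zero>\<^bsub>M\<^esub>" if "\<forall>i\<in>I. f i \<in> S i" "finsum M f I = \<zero>\<^bsub>M\<^esub>" "i \<in> I" for f i
    by (rule EU[THEN conjunct2, rule_format, OF conjI[OF that(1,2)] that(3)])
  have "\<exists>!f. f \<in> (\<Pi>\<^sub>E i\<in>I. S i) \<and> finsum M f I = x" if x: "x \<in> carrier M" for x
  proof (rule ex_ex1I)
    obtain f where "\<forall>i\<in>I. f i \<in> S i" "finsum M f I = x" using E[OF x] by (elim exE conjE)
    then show "\<exists>f. f \<in> (\<Pi>\<^sub>E i\<in>I. S i) \<and> finsum M f I = x"
      using restr[of f] by (intro exI[of _ "restrict f I"]) simp
  next
    fix f g
    assume f: "f \<in> (\<Pi>\<^sub>E i\<in>I. S i) \<and> finsum M f I = x" and g: "g \<in> (\<Pi>\<^sub>E i\<in>I. S i) \<and> finsum M g I = x"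
    have fS: "f i \<in> S i" and gS: "g i \<in> S i" if "i \<in> I" for i
      using PiE_mem[OF conjunct1[OF f] that] PiE_mem[OF conjunct1[OF g] that] by auto
    have fc: "f \<in> I \<rightarrow> carrier M" using fS subsetD[OF sub] by (intro Pi_I) simp
    have gc: "g \<in> I \<rightarrow> carrier M" using gS subsetD[OF sub] by (intro Pi_I) simp
    have "finsum M (\<lambda>i. f i \<oplus>\<^bsub>M\<^esub> (\<ominus>\<^bsub>M\<^esub> g i)) I = finsum M f I \<oplus>\<^bsub>M\<^esub> finsum M (\<lambda>i. \<ominus>\<^bsub>M\<^esub> g i) I"
      using fc gc by (intro M.finsum_addf) auto
    also have "\<dots> = \<zero>\<^bsub>M\<^esub>" using f g finsum_minus[OF assms(1) gc] x by (simp add: M.r_neg)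
    finally have z: "finsum M (\<lambda>i. f i \<oplus>\<^bsub>M\<^esub> (\<ominus>\<^bsub>M\<^esub> g i)) I = \<zero>\<^bsub>M\<^esub>" .
    have w: "\<forall>i\<in>I. f i \<oplus>\<^bsub>M\<^esub> (\<ominus>\<^bsub>M\<^esub> g i) \<in> S i"
    proof
      fix i assume i: "i \<in> I"
      show "f i \<oplus>\<^bsub>M\<^esub> (\<ominus>\<^bsub>M\<^esub> g i) \<in> S i"
        by (rule submod_add[OF assms(2)[OF i] fS[OF i] submod_neg[OF assms(2)[OF i] gS[OF i]]])
    qed
    have "\<forall>i\<in>I. f i \<oplus>\<^bsub>M\<^esub> (\<ominus>\<^bsub>M\<^esub> g i) = \<zero>\<^bsub>M\<^esub>"
      by (rule ballI, rule U[OF w z])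
    then have "\<forall>i\<in>I. f i = g i"
      using fc gc eq_if_diff_zero unfolding a_minus_def by (meson Pi_mem)
    then show "f = g" using PiE_ext[OF conjunct1[OF f] conjunct1[OF g]] by simp
  qed
  then show "direct_sum_family R M I S"
    unfolding direct_sum_family_def by (intro conjI ballI assms(2))
qed

lemma finsum_option:
  assumes "finite I" "f None \<in> carrier M" "\<And>i. i \<in> I \<Longrightarrow> f (Some i) \<in> carrier M"
  shows "finsum M f (insert None (Some ` I)) = f None \<oplus>\<^bsub>M\<^esub> finsum M (\<lambda>i. f (Some i)) I"
proof -
  have "finsum M f (Some ` I) = finsum M (\<lambda>i. f (Some i)) I"
    using assms by (intro M.finsum_reindex) auto
  then show ?thesis using assms by (subst M.finsum_insert) auto
qed

lemma finsum_only:
  assumes "finite I" "i \<in> I" "x \<in> carrier M"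
  shows "finsum M (\<lambda>j. if j = i then x else \<zero>\<^bsub>M\<^esub>) I = x"
  using M.add.finprod_singleton_swap[of i I "\<lambda>_. x"] assms by simp

end

locale module_surj = left_module R X
  for R :: "('a, 'r) ring_scheme" and X :: "('a, 'x, 'm) module_scheme" +
  fixes Y :: "('a, 'y, 'n) module_scheme" and p :: "'x \<Rightarrow> 'y"
  assumes onto: "carrier Y = p ` carrier X"
    and zero: "\<zero>\<^bsub>Y\<^esub> = p \<zero>\<^bsub>X\<^esub>"
    and add: "x \<in> carrier X \<Longrightarrow> y \<in> carrier X \<Longrightarrow> p (x \<oplus>\<^bsub>X\<^esub> y) = p x \<oplus>\<^bsub>Y\<^esub> p y"
    and smult: "a \<in> carrier R \<Longrightarrow> x \<in> carrier X \<Longrightarrow> p (a \<odot>\<^bsub>X\<^esub> x) = a \<odot>\<^bsub>Y\<^esub> p x"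
begin

lemma abelian_Y: "abelian_group Y"
proof (rule abelian_groupI)
  fix y assume "y \<in> carrier Y"
  then obtain x where x: "x \<in> carrier X" "y = p x" using onto by auto
  then show "\<zero>\<^bsub>Y\<^esub> \<oplus>\<^bsub>Y\<^esub> y = y" using add[of "\<zero>\<^bsub>X\<^esub>" x] zero by simp
  have "p (\<ominus>\<^bsub>X\<^esub> x) \<oplus>\<^bsub>Y\<^esub> y = \<zero>\<^bsub>Y\<^esub>" using add[of "\<ominus>\<^bsub>X\<^esub> x" x] x zero by (simp add: M.l_neg)
  then show "\<exists>z\<in>carrier Y. z \<oplus>\<^bsub>Y\<^esub> y = \<zero>\<^bsub>Y\<^esub>" using x onto by blast
next
  show "\<zero>\<^bsub>Y\<^esub> \<in> carrier Y" using zero onto by simp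
next
  fix y z assume "y \<in> carrier Y" "z \<in> carrier Y"
  then obtain x w where x: "x \<in> carrier X" "y = p x" "w \<in> carrier X" "z = p w" using onto by auto
  then show "y \<oplus>\<^bsub>Y\<^esub> z = z \<oplus>\<^bsub>Y\<^esub> y"
    using add[of x w] add[of w x] M.a_comm[of x w] by simp
  show "y \<oplus>\<^bsub>Y\<^esub> z \<in> carrier Y"
    using x add[of x w] onto M.a_closed[of x w] imageI[of "x \<oplus>\<^bsub>X\<^esub> w" "carrier X" p] by simp
next
  fix y z u assume "y \<in> carrier Y" "z \<in> carrier Y" "u \<in> carrier Y"
  then obtain x w v where x: "x \<in> carrier X" "y = p x" "w \<in> carrier X" "z = p w"
    "v \<in> carrier X" "u = p v" using onto by auto
  then show "y \<oplus>\<^bsub>Y\<^esub> z \<oplus>\<^bsub>Y\<^esub> u = y \<oplus>\<^bsub>Y\<^esub> (z \<oplus>\<^bsub>Y\<^esub> u)"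
    using add[of x w] add[of "x \<oplus>\<^bsub>X\<^esub> w" v] add[of w v] add[of x "w \<oplus>\<^bsub>X\<^esub> v"] M.a_assoc[of x w v]
    by simp
qed

lemma module_Y: "left_module R Y"
proof (intro left_module.intro left_module_axioms.intro abelian_Y R.ring_axioms)
  fix a y assume a: "a \<in> carrier R" "y \<in> carrier Y"
  then obtain x where x: "x \<in> carrier X" "y = p x" using onto by auto
  then show "a \<odot>\<^bsub>Y\<^esub> y \<in> carrier Y" using a smult[of a x] onto imageI[of "a \<odot>\<^bsub>X\<^esub> x" "carrier X" p] by simp
  fix b assume b: "b \<in> carrier R"
  show "(a \<oplus>\<^bsub>R\<^esub> b) \<odot>\<^bsub>Y\<^esub> y = a \<odot>\<^bsub>Y\<^esub> y \<oplus>\<^bsub>Y\<^esub> b \<odot>\<^bsub>Y\<^esub> y"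
    using a b x smult[of "a \<oplus>\<^bsub>R\<^esub> b" x] smult[of a x] smult[of b x]
      add[of "a \<odot>\<^bsub>X\<^esub> x" "b \<odot>\<^bsub>X\<^esub> x"] smult_l_distr[of a b x] by simp
  show "(a \<otimes>\<^bsub>R\<^esub> b) \<odot>\<^bsub>Y\<^esub> y = a \<odot>\<^bsub>Y\<^esub> (b \<odot>\<^bsub>Y\<^esub> y)"
    using a b x smult[of "a \<otimes>\<^bsub>R\<^esub> b" x] smult[of b x] smult[of a "b \<odot>\<^bsub>X\<^esub> x"]
      smult_assoc1[of a b x] by simp
next
  fix y assume "y \<in> carrier Y"
  then obtain x where x: "x \<in> carrier X" "y = p x" using onto by auto
  then show "\<one>\<^bsub>R\<^esub> \<odot>\<^bsub>Y\<^esub> y = y" using smult[of "\<one>\<^bsub>R\<^esub>" x] by simp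
next
  fix a y z assume a: "a \<in> carrier R" "y \<in> carrier Y" "z \<in> carrier Y"
  then obtain x w where x: "x \<in> carrier X" "y = p x" "w \<in> carrier X" "z = p w" using onto by auto
  then show "a \<odot>\<^bsub>Y\<^esub> (y \<oplus>\<^bsub>Y\<^esub> z) = a \<odot>\<^bsub>Y\<^esub> y \<oplus>\<^bsub>Y\<^esub> a \<odot>\<^bsub>Y\<^esub> z"
    using a add[of x w] smult[of a "x \<oplus>\<^bsub>X\<^esub> w"] smult[of a x] smult[of a w]
      add[of "a \<odot>\<^bsub>X\<^esub> x" "a \<odot>\<^bsub>X\<^esub> w"] smult_r_distr[of a x w] by simp
qed

lemma neg: assumes "x \<in> carrier X" shows "p (\<ominus>\<^bsub>X\<^esub> x) = \<ominus>\<^bsub>Y\<^esub> p x"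
proof -
  interpret Y: left_module R Y by (rule module_Y)
  have "p (\<ominus>\<^bsub>X\<^esub> x) \<oplus>\<^bsub>Y\<^esub> p x = \<zero>\<^bsub>Y\<^esub>"
    using assms add[of "\<ominus>\<^bsub>X\<^esub> x" x] zero by (simp add: M.l_neg)
  then show ?thesis 
    using assms onto Y.minus_equality[of "p (\<ominus>\<^bsub>X\<^esub> x)" "p x"] by simp
qed

lemma sum:
  assumes "finite I" "f \<in> I \<rightarrow> carrier X"
  shows "p (finsum X f I) = finsum Y (\<lambda>i. p (f i)) I"
proof -
  interpret Y: left_module R Y by (rule module_Y)
  show ?thesis using assms
  proof (induction I)
    case empty
    then show ?case using zero by simp
  next
    case (insert i I)
    then have "f \<in> I \<rightarrow> carrier X" "f i \<in> carrier X" "(\<lambda>i. p (f i)) \<in> I \<rightarrow> carrier Y"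
      "p (f i) \<in> carrier Y" using onto by auto
    then show ?case using insert add by simp
  qed
qed

lemma image_submodule:
  assumes "submodule H R X" shows "submodule (p ` H) R Y"
proof -
  interpret Y: left_module R Y by (rule module_Y)
  have H: "H \<subseteq> carrier X" by (rule submod_sub[OF assms])
  show ?thesis
  proof (rule Y.submodI)
    show "p ` H \<subseteq> carrier Y" using H onto by auto
    show "\<zero>\<^bsub>Y\<^esub> \<in> p ` H" using zero submod_zero[OF assms] by auto
    show "x \<oplus>\<^bsub>Y\<^esub> y \<in> p ` H" if "x \<in> p ` H" "y \<in> p ` H" for x y
    proof -
      obtain u v where u: "u \<in> H" "x = p u" "v \<in> H" "y = p v" using \<open>x \<in> p ` H\<close> \<open>y \<in> p ` H\<close> by blast
      then have "x \<oplus>\<^bsub>Y\<^esub> y = p (u \<oplus>\<^bsub>X\<^esub> v)" using add[of u v] subsetD[OF H] by simp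
      then show ?thesis using submod_add[OF assms u(1,3)] by blast
    qed
    show "\<ominus>\<^bsub>Y\<^esub> x \<in> p ` H" if "x \<in> p ` H" for x
    proof -
      obtain u where u: "u \<in> H" "x = p u" using \<open>x \<in> p ` H\<close> by blast
      then have "\<ominus>\<^bsub>Y\<^esub> x = p (\<ominus>\<^bsub>X\<^esub> u)" using neg[of u] subsetD[OF H] by simp
      then show ?thesis using submod_neg[OF assms u(1)] by blast
    qed
    show "a \<odot>\<^bsub>Y\<^esub> x \<in> p ` H" if "a \<in> carrier R" "x \<in> p ` H" for a x
    proof -
      obtain u where u: "u \<in> H" "x = p u" using \<open>x \<in> p ` H\<close> by blast
      then have "a \<odot>\<^bsub>Y\<^esub> x = p (a \<odot>\<^bsub>X\<^esub> u)" using smult[of a u] subsetD[OF H] \<open>a \<in> carrier R\<close> by simp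
      then show ?thesis using submod_smult[OF assms \<open>a \<in> carrier R\<close> u(1)] by blast
    qed
  qed
qed

lemma preimage_submodule:
  assumes "submodule H R X" "submodule K R Y" shows "submodule {x \<in> H. p x \<in> K} R X"
proof -
  interpret Y: left_module R Y by (rule module_Y)
  have H: "H \<subseteq> carrier X" by (rule submod_sub[OF assms(1)])
  show ?thesis
  proof (rule submodI)
    show "{x \<in> H. p x \<in> K} \<subseteq> carrier X" using H by blast
    show "\<zero>\<^bsub>X\<^esub> \<in> {x \<in> H. p x \<in> K}"
      using submod_zero[OF assms(1)] Y.submod_zero[OF assms(2)] by (simp add: zero)
    show "x \<oplus>\<^bsub>X\<^esub> y \<in> {x \<in> H. p x \<in> K}" if x: "x \<in> {x \<in> H. p x \<in> K}" "y \<in> {x \<in> H. p x \<in> K}" for x y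
      using x subsetD[OF H, of x] subsetD[OF H, of y] add[of x y] submod_add[OF assms(1), of x y] Y.submod_add[OF assms(2), of "p x" "p y"] by auto
    show "\<ominus>\<^bsub>X\<^esub> x \<in> {x \<in> H. p x \<in> K}" if x: "x \<in> {x \<in> H. p x \<in> K}" for x
      using x subsetD[OF H, of x] neg[of x] submod_neg[OF assms(1), of x] Y.submod_neg[OF assms(2), of "p x"] by auto
    show "a \<odot>\<^bsub>X\<^esub> x \<in> {x \<in> H. p x \<in> K}" if x: "a \<in> carrier R" "x \<in> {x \<in> H. p x \<in> K}" for a x
      using x subsetD[OF H, of x] smult[of a x] submod_smult[OF assms(1), of a x] Y.submod_smult[OF assms(2), of a "p x"] by auto
  qed
qed

end

theorem finite_exchange_any_universe:
  fixes R :: "('a, 'r) ring_scheme" and M :: "('a, 'b, 'm) module_scheme"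
  assumes M: "left_module R M" and ex: "finite_exchange TYPE(nat \<Rightarrow> 'b) R M"
  shows "finite_exchange TYPE('x) R M"
  unfolding finite_exchange_def
proof (intro allI impI, elim conjE exE)
  fix X :: "('a, 'x) module" and M' N and I :: "nat set" and S h
  assume X: "left_module R X" and MN: "direct_sum R X M' N"
    and h: "h \<in> module_iso R M (X\<lparr>carrier := M'\<rparr>)"
    and I: "finite I" and S: "direct_sum_family R X I S"
  interpret M: left_module R M by (rule M)
  interpret X: left_module R X by (rule X)
  have M'sub: "submodule M' R X" and Nsub: "submodule N R X"
    and cX: "carrier X = M' <+>\<^bsub>X\<^esub> N" and MN0: "M' \<inter> N = {\<zero>\<^bsub>X\<^esub>}"
    using MN unfolding direct_sum_def by auto
  have M'c: "M' \<subseteq> carrier X" and Nc: "N \<subseteq> carrier X"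
    using M'sub Nsub X.submod_sub by auto
  have hb: "bij_betw h (carrier M) M'"
    and hadd: "\<And>x y. x \<in> carrier M \<Longrightarrow> y \<in> carrier M \<Longrightarrow> h (x \<oplus>\<^bsub>M\<^esub> y) = h x \<oplus>\<^bsub>X\<^esub> h y"
    and hsm: "\<And>a x. a \<in> carrier R \<Longrightarrow> x \<in> carrier M \<Longrightarrow> h (a \<odot>\<^bsub>M\<^esub> x) = a \<odot>\<^bsub>X\<^esub> h x"
    using h unfolding module_iso_def by auto
  have hM': "h x \<in> M'" if "x \<in> carrier M" for x using hb that by (metis bij_betwE)
  have hc: "h x \<in> carrier X" if "x \<in> carrier M" for x using hM' M'c that by blast
  have hinj: "x = y" if "x \<in> carrier M" "y \<in> carrier M" "h x = h y" for x y
    using hb that by (metis bij_betw_def inj_onD)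
  have hzero: "h \<zero>\<^bsub>M\<^esub> = \<zero>\<^bsub>X\<^esub>"
    using hadd[of "\<zero>\<^bsub>M\<^esub>" "\<zero>\<^bsub>M\<^esub>"] hc[of "\<zero>\<^bsub>M\<^esub>"] by simp

  \<comment> \<open>the projection onto \<open>M'\<close> along \<open>N\<close>, followed by the inverse of \<open>h\<close>\<close>
  have split: "\<exists>!m. m \<in> carrier M \<and> (\<exists>n\<in>N. x = h m \<oplus>\<^bsub>X\<^esub> n)" if x: "x \<in> carrier X" for x
  proof (rule ex_ex1I)
    have "x \<in> M' <+>\<^bsub>X\<^esub> N" using x cX by simp
    then obtain m' n where mn: "m' \<in> M'" "n \<in> N" "x = m' \<oplus>\<^bsub>X\<^esub> n"
      unfolding set_add_def set_mult_def by auto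
    then obtain m where "m \<in> carrier M" "h m = m'" using hb unfolding bij_betw_def by blast
    then show "\<exists>m. m \<in> carrier M \<and> (\<exists>n\<in>N. x = h m \<oplus>\<^bsub>X\<^esub> n)" using mn by blast
  next
    fix m k
    assume "m \<in> carrier M \<and> (\<exists>n\<in>N. x = h m \<oplus>\<^bsub>X\<^esub> n)" "k \<in> carrier M \<and> (\<exists>n\<in>N. x = h k \<oplus>\<^bsub>X\<^esub> n)"
    then obtain n n' where m: "m \<in> carrier M" "k \<in> carrier M" "n \<in> N" "n' \<in> N"
      "x = h m \<oplus>\<^bsub>X\<^esub> n" "x = h k \<oplus>\<^bsub>X\<^esub> n'" by auto
    have c: "h m \<in> carrier X" "h k \<in> carrier X" "n \<in> carrier X" "n' \<in> carrier X"
      using m hc Nc by auto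
    have "h m \<oplus>\<^bsub>X\<^esub> n = h k \<oplus>\<^bsub>X\<^esub> n'" using m by simp
    then have e: "h m \<ominus>\<^bsub>X\<^esub> h k = n' \<ominus>\<^bsub>X\<^esub> n"
      using c by (smt (verit) X.M.a_assoc X.M.a_comm X.M.a_inv_closed X.M.minus_closed X.M.r_neg X.M.r_zero a_minus_def)
    have "h m \<ominus>\<^bsub>X\<^esub> h k \<in> M'" using m hM' X.submod_diff[OF M'sub] by blast
    moreover have "n' \<ominus>\<^bsub>X\<^esub> n \<in> N" using m X.submod_diff[OF Nsub] by blast
    ultimately have "h m \<ominus>\<^bsub>X\<^esub> h k = \<zero>\<^bsub>X\<^esub>" using e MN0 by auto
    then have "h m = h k" using c X.eq_if_diff_zero by blast
    then show "m = k" using hinj m by blast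
  qed
  define p where "p x = (THE m. m \<in> carrier M \<and> (\<exists>n\<in>N. x = h m \<oplus>\<^bsub>X\<^esub> n))" for x
  have pI: "p x \<in> carrier M \<and> (\<exists>n\<in>N. x = h (p x) \<oplus>\<^bsub>X\<^esub> n)" if "x \<in> carrier X" for x
    unfolding p_def by (rule theI'[OF split[OF that]])
  have pE: "p x = m" if "m \<in> carrier M" "n \<in> N" "x = h m \<oplus>\<^bsub>X\<^esub> n" for x m n
  proof -
    have xc: "x \<in> carrier X" 
      unfolding that(3) by (rule X.M.a_closed[OF hc[OF that(1)] subsetD[OF Nc that(2)]])
    have "m \<in> carrier M \<and> (\<exists>n\<in>N. x = h m \<oplus>\<^bsub>X\<^esub> n)"
      by (intro conjI bexI[of _ n] that)
    then show ?thesis by (rule ex1_unique[OF split[OF xc] pI[OF xc]])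
  qed
  have pc: "p x \<in> carrier M" if "x \<in> carrier X" for x by (rule conjunct1[OF pI[OF that]])
  have pD: "\<exists>n\<in>N. x = h (p x) \<oplus>\<^bsub>X\<^esub> n" if "x \<in> carrier X" for x by (rule conjunct2[OF pI[OF that]])
  have padd: "p (x \<oplus>\<^bsub>X\<^esub> y) = p x \<oplus>\<^bsub>M\<^esub> p y" if t: "x \<in> carrier X" "y \<in> carrier X" for x y
  proof -
    obtain n where n1: "n \<in> N" "x = h (p x) \<oplus>\<^bsub>X\<^esub> n" by (rule bexE[OF pD[OF t(1)]])
    obtain n' where n2: "n' \<in> N" "y = h (p y) \<oplus>\<^bsub>X\<^esub> n'" by (rule bexE[OF pD[OF t(2)]])
    note n = n1(1) n2(1) n1(2) n2(2)
    have c: "h (p x) \<in> carrier X" "h (p y) \<in> carrier X" "n \<in> carrier X" "n' \<in> carrier X"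
      using n(1,2) hc pc Nc t by blast+
    have "(h (p x) \<oplus>\<^bsub>X\<^esub> n) \<oplus>\<^bsub>X\<^esub> (h (p y) \<oplus>\<^bsub>X\<^esub> n') = (h (p x) \<oplus>\<^bsub>X\<^esub> h (p y)) \<oplus>\<^bsub>X\<^esub> (n \<oplus>\<^bsub>X\<^esub> n')"
      using c by (simp add: X.M.a_ac)
    then have e: "x \<oplus>\<^bsub>X\<^esub> y = h (p x \<oplus>\<^bsub>M\<^esub> p y) \<oplus>\<^bsub>X\<^esub> (n \<oplus>\<^bsub>X\<^esub> n')"
      unfolding n(3,4)[symmetric] hadd[OF pc[OF t(1)] pc[OF t(2)]] .
    show ?thesis
      by (rule pE[OF M.M.a_closed[OF pc[OF t(1)] pc[OF t(2)]] X.submod_add[OF Nsub n(1,2)] e])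
  qed
  have psm: "p (a \<odot>\<^bsub>X\<^esub> x) = a \<odot>\<^bsub>M\<^esub> p x" if t: "a \<in> carrier R" "x \<in> carrier X" for a x
  proof -
    obtain n where n: "n \<in> N" "x = h (p x) \<oplus>\<^bsub>X\<^esub> n" by (rule bexE[OF pD[OF t(2)]])
    have "a \<odot>\<^bsub>X\<^esub> (h (p x) \<oplus>\<^bsub>X\<^esub> n) = a \<odot>\<^bsub>X\<^esub> h (p x) \<oplus>\<^bsub>X\<^esub> a \<odot>\<^bsub>X\<^esub> n"
      using n(1) hc pc Nc t by (intro X.smult_r_distr) blast+
    then have e: "a \<odot>\<^bsub>X\<^esub> x = h (a \<odot>\<^bsub>M\<^esub> p x) \<oplus>\<^bsub>X\<^esub> a \<odot>\<^bsub>X\<^esub> n"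
      unfolding n(2)[symmetric] hsm[OF t(1) pc[OF t(2)]] .
    show ?thesis
      by (rule pE[OF M.smult_closed[OF t(1) pc[OF t(2)]] X.submod_smult[OF Nsub t(1) n(1)] e])
  qed
  have pN: "p x = \<zero>\<^bsub>M\<^esub>" if "x \<in> N" for x
    using pE[of "\<zero>\<^bsub>M\<^esub>" x x] that hzero Nc by auto
  have pker: "x \<in> N" if t: "x \<in> carrier X" "p x = \<zero>\<^bsub>M\<^esub>" for x
  proof -
    obtain n where n: "n \<in> N" "x = h (p x) \<oplus>\<^bsub>X\<^esub> n" by (rule bexE[OF pD[OF t(1)]])
    have "x = n" using n(2) unfolding t(2) hzero using subsetD[OF Nc n(1)] by simp
    then show ?thesis using n(1) by simp
  qed
  have ph: "p (h m) = m" if "m \<in> carrier M" for m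
    using pE[of m "\<zero>\<^bsub>X\<^esub>" "h m"] that hc X.submod_zero[OF Nsub] by simp

  \<comment> \<open>components with respect to the family \<open>S\<close>\<close>
  have Ssub: "submodule (S i) R X" if "i \<in> I" for i
    by (rule S[unfolded direct_sum_family_def, THEN conjunct1, rule_format, OF that])
  have Sc: "S i \<subseteq> carrier X" if "i \<in> I" for i using X.submod_sub[OF Ssub[OF that]] .
  have S1: "\<exists>!f. f \<in> (\<Pi>\<^sub>E i\<in>I. S i) \<and> finsum X f I = x" if "x \<in> carrier X" for x
    by (rule S[unfolded direct_sum_family_def, THEN conjunct2, rule_format, OF that])
  define c where "c x = (THE f. f \<in> (\<Pi>\<^sub>E i\<in>I. S i) \<and> finsum X f I = x)" for x
  have cI: "c x \<in> (\<Pi>\<^sub>E i\<in>I. S i) \<and> finsum X (c x) I = x" if "x \<in> carrier X" for x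
    unfolding c_def by (rule theI'[OF S1[OF that]])
  have cS: "c x i \<in> S i" if "x \<in> carrier X" "i \<in> I" for x i by (rule PiE_mem[OF conjunct1[OF cI[OF that(1)]] that(2)])
  have cc: "c x i \<in> carrier X" if "x \<in> carrier X" "i \<in> I" for x i using cS Sc that by blast
  have csum: "finsum X (c x) I = x" if "x \<in> carrier X" for x by (rule conjunct2[OF cI[OF that]])
  have cE: "c x i = f i" if f: "\<And>i. i \<in> I \<Longrightarrow> f i \<in> S i" and x: "finsum X f I = x" and i: "i \<in> I"
    for x i f
  proof -
    have fc: "f \<in> I \<rightarrow> carrier X" using f Sc by blast
    have xc: "x \<in> carrier X" using fc x by auto
    have "finsum X (restrict f I) I = finsum X f I"
      using fc by (intro X.M.finsum_cong') auto
    then have r: "restrict f I \<in> (\<Pi>\<^sub>E i\<in>I. S i) \<and> finsum X (restrict f I) I = x" using f x by simp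
    have "c x = restrict f I"
      by (rule ex1_unique[OF S1[OF xc]], rule cI[OF xc], rule r)
    then show ?thesis using i by simp
  qed
  have cadd: "c (x \<oplus>\<^bsub>X\<^esub> y) i = c x i \<oplus>\<^bsub>X\<^esub> c y i" if "x \<in> carrier X" "y \<in> carrier X" "i \<in> I" for x y i
  proof (rule cE[of "\<lambda>i. c x i \<oplus>\<^bsub>X\<^esub> c y i"])
    show "c x i \<oplus>\<^bsub>X\<^esub> c y i \<in> S i" if "i \<in> I" for i
      using X.submod_add[OF Ssub] cS that \<open>x \<in> carrier X\<close> \<open>y \<in> carrier X\<close> by blast
    have "finsum X (\<lambda>i. c x i \<oplus>\<^bsub>X\<^esub> c y i) I = finsum X (c x) I \<oplus>\<^bsub>X\<^esub> finsum X (c y) I"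
      using that cc by (intro X.M.finsum_addf) auto
    then show "finsum X (\<lambda>i. c x i \<oplus>\<^bsub>X\<^esub> c y i) I = x \<oplus>\<^bsub>X\<^esub> y" using csum that by simp
  qed (use that in auto)
  have sum_smult: "finsum X (\<lambda>i. a \<odot>\<^bsub>X\<^esub> f i) J = a \<odot>\<^bsub>X\<^esub> finsum X f J"
    if "finite J" "f \<in> J \<rightarrow> carrier X" "a \<in> carrier R" for a f and J :: "nat set"
    using that
  proof (induction J)
    case empty
    then show ?case by (simp add: X.smult_r_zero)
  next
    case (insert i J)
    then have "f \<in> J \<rightarrow> carrier X" "f i \<in> carrier X" "(\<lambda>i. a \<odot>\<^bsub>X\<^esub> f i) \<in> J \<rightarrow> carrier X" by auto
    then show ?case using insert by (simp add: X.smult_r_distr)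
  qed
  have csm: "c (a \<odot>\<^bsub>X\<^esub> x) i = a \<odot>\<^bsub>X\<^esub> c x i" if "a \<in> carrier R" "x \<in> carrier X" "i \<in> I" for a x i
  proof (rule cE[of "\<lambda>i. a \<odot>\<^bsub>X\<^esub> c x i"])
    show "a \<odot>\<^bsub>X\<^esub> c x i \<in> S i" if "i \<in> I" for i
      using X.submod_smult[OF Ssub] cS that \<open>x \<in> carrier X\<close> \<open>a \<in> carrier R\<close> by blast
    show "finsum X (\<lambda>i. a \<odot>\<^bsub>X\<^esub> c x i) I = a \<odot>\<^bsub>X\<^esub> x"
      using sum_smult[OF I, of "c x" a] that cc csum by auto
  qed (use that in auto)
  have cS': "c x j = (if j = i then x else \<zero>\<^bsub>X\<^esub>)" if "i \<in> I" "x \<in> S i" "j \<in> I" for x i j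
    using that Sc by (intro cE X.finsum_only I) (auto intro: X.submod_zero[OF Ssub])

  \<comment> \<open>the image of \<open>X\<close> in the direct power of \<open>M\<close>\<close>
  define q where "q x = (\<lambda>i. if i \<in> I then p (c x i) else undefined)" for x
  define Y :: "('a, nat \<Rightarrow> 'b) module" where
    "Y = \<lparr>carrier = q ` carrier X, mult = (\<lambda>_ _. undefined), one = undefined,
      zero = q \<zero>\<^bsub>X\<^esub>, add = (\<lambda>f g i. if i \<in> I then f i \<oplus>\<^bsub>M\<^esub> g i else undefined),
      smult = (\<lambda>a f i. if i \<in> I then a \<odot>\<^bsub>M\<^esub> f i else undefined)\<rparr>"
  interpret q: module_surj R X Y q
  proof unfold_locales
    show "carrier Y = q ` carrier X" "\<zero>\<^bsub>Y\<^esub> = q \<zero>\<^bsub>X\<^esub>" by (simp_all add: Y_def)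
    show "q (x \<oplus>\<^bsub>X\<^esub> y) = q x \<oplus>\<^bsub>Y\<^esub> q y" if "x \<in> carrier X" "y \<in> carrier X" for x y
      using that cc by (auto simp: q_def Y_def fun_eq_iff cadd padd)
    show "q (a \<odot>\<^bsub>X\<^esub> x) = a \<odot>\<^bsub>Y\<^esub> q x" if "a \<in> carrier R" "x \<in> carrier X" for a x
      using that cc by (auto simp: q_def Y_def fun_eq_iff csm psm)
  qed
  interpret Y: left_module R Y by (rule q.module_Y)
  have qY: "q x \<in> carrier Y" if "x \<in> carrier X" for x using q.onto that by blast
  have c0: "c \<zero>\<^bsub>X\<^esub> i = \<zero>\<^bsub>X\<^esub>" if "i \<in> I" for i
    using cE[of "\<lambda>_. \<zero>\<^bsub>X\<^esub>" "\<zero>\<^bsub>X\<^esub>"] that X.submod_zero[OF Ssub] by simp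
  have p0: "p \<zero>\<^bsub>X\<^esub> = \<zero>\<^bsub>M\<^esub>" using pN X.submod_zero[OF Nsub] by blast
  have q0: "q x = \<zero>\<^bsub>Y\<^esub> \<longleftrightarrow> (\<forall>i\<in>I. p (c x i) = \<zero>\<^bsub>M\<^esub>)" for x
    by (auto simp: q.zero q_def fun_eq_iff c0 p0)
  have qN: "x \<in> N" if "x \<in> carrier X" "q x = \<zero>\<^bsub>Y\<^esub>" for x
  proof -
    have "\<And>i. i \<in> I \<Longrightarrow> c x i \<in> N" using that q0 pker cc by blast
    then show ?thesis using X.submod_sum[OF Nsub I, of "c x"] csum that by simp
  qed
  have qdiff: "q (x \<ominus>\<^bsub>X\<^esub> y) = q x \<ominus>\<^bsub>Y\<^esub> q y" if "x \<in> carrier X" "y \<in> carrier X" for x y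
    using that by (simp add: a_minus_def q.add q.neg)
  have qeq: "x \<ominus>\<^bsub>X\<^esub> y \<in> N" if "x \<in> carrier X" "y \<in> carrier X" "q x = q y" for x y
    using that qdiff[of x y] Y.M.r_neg[OF qY[of y]] by (intro qN) (simp_all add: a_minus_def)

  have D1: "direct_sum R Y (q ` M') (q ` N)"
    unfolding direct_sum_def
  proof (intro conjI q.image_submodule M'sub Nsub)
    show "q ` M' <+>\<^bsub>Y\<^esub> q ` N = carrier Y"
    proof (intro equalityI subsetI)
      fix y assume "y \<in> q ` M' <+>\<^bsub>Y\<^esub> q ` N"
      then show "y \<in> carrier Y" using M'c Nc qY unfolding set_add_def set_mult_def by auto
    next
      fix y assume "y \<in> carrier Y"
      then obtain x where x: "x \<in> carrier X" "y = q x" using q.onto by blast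
      then obtain m n where "m \<in> M'" "n \<in> N" "x = m \<oplus>\<^bsub>X\<^esub> n"
        using cX unfolding set_add_def set_mult_def by auto
      then have "y = q m \<oplus>\<^bsub>Y\<^esub> q n" "m \<in> M'" "n \<in> N" using x q.add M'c Nc by auto
      then show "y \<in> q ` M' <+>\<^bsub>Y\<^esub> q ` N" unfolding set_add_def set_mult_def by auto
    qed
    show "q ` M' \<inter> q ` N = {\<zero>\<^bsub>Y\<^esub>}"
    proof (intro equalityI subsetI)
      fix y assume "y \<in> q ` M' \<inter> q ` N"
      then obtain m n where mn: "m \<in> M'" "n \<in> N" "y = q m" "y = q n" by blast
      then have c: "m \<in> carrier X" "n \<in> carrier X" using M'c Nc by auto
      have "m \<ominus>\<^bsub>X\<^esub> n \<oplus>\<^bsub>X\<^esub> n \<in> N"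
        using qeq[of m n] c mn X.submod_add[OF Nsub] by simp
      then have "m \<in> N" using c by (simp add: a_minus_def X.M.a_assoc X.M.l_neg)
      then have "m = \<zero>\<^bsub>X\<^esub>" using mn MN0 by blast
      then show "y \<in> {\<zero>\<^bsub>Y\<^esub>}" using mn q.zero by simp
    next
      fix y assume "y \<in> {\<zero>\<^bsub>Y\<^esub>}"
      then show "y \<in> q ` M' \<inter> q ` N"
        using q.zero X.submod_zero[OF M'sub] X.submod_zero[OF Nsub] by auto
    qed
  qed

  have D2: "q \<circ> h \<in> module_iso R M (Y\<lparr>carrier := q ` M'\<rparr>)"
  proof -
    have "inj_on (q \<circ> h) (carrier M)"
    proof (rule inj_onI)
      fix x y assume a: "x \<in> carrier M" "y \<in> carrier M" "(q \<circ> h) x = (q \<circ> h) y"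
      then have "h x \<ominus>\<^bsub>X\<^esub> h y \<in> N" using qeq hc by simp
      moreover have "h x \<ominus>\<^bsub>X\<^esub> h y \<in> M'" using a hM' X.submod_diff[OF M'sub] by blast
      ultimately have "h x \<ominus>\<^bsub>X\<^esub> h y = \<zero>\<^bsub>X\<^esub>" using MN0 by blast
      then show "x = y" using a hc[of x] hc[of y] hinj[of x y] X.eq_if_diff_zero[of "h x" "h y"] by simp
    qed
    moreover have "(q \<circ> h) ` carrier M = q ` M'"
      using hb unfolding bij_betw_def by (metis image_comp)
    ultimately show ?thesis
      unfolding module_iso_def bij_betw_def using hadd hsm hc q.add q.smult by simp
  qed

  have qS: "submodule (q ` S i) R Y" if "i \<in> I" for i
    using q.image_submodule[OF Ssub[OF that]] .
  have qsum: "q (finsum X f I) = finsum Y (\<lambda>i. q (f i)) I" if "\<And>i. i \<in> I \<Longrightarrow> f i \<in> carrier X" for f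
    using q.sum[OF I, of f] that by auto
  have D3: "direct_sum_family R Y I (\<lambda>i. q ` S i)"
  proof (subst Y.direct_sum_family_iff[OF I qS], assumption, intro conjI ballI allI impI)
    fix y assume "y \<in> carrier Y"
    then obtain x where x: "x \<in> carrier X" "y = q x" using q.onto by blast
    have "finsum Y (\<lambda>i. q (c x i)) I = y" using qsum[of "c x"] cc csum x by simp
    then show "\<exists>f. (\<forall>i\<in>I. f i \<in> q ` S i) \<and> finsum Y f I = y"
      using cS x by (intro exI[of _ "\<lambda>i. q (c x i)"]) auto
  next
    fix f j assume f: "(\<forall>i\<in>I. f i \<in> q ` S i) \<and> finsum Y f I = \<zero>\<^bsub>Y\<^esub>" and j: "j \<in> I"
    have "\<forall>i\<in>I. \<exists>z. z \<in> S i \<and> f i = q z" using conjunct1[OF f] by blast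
    then obtain g where g: "\<forall>i\<in>I. g i \<in> S i \<and> f i = q (g i)" by (rule bchoice[THEN exE])
    have gS: "g i \<in> S i" and fg: "f i = q (g i)" if "i \<in> I" for i using g that by simp_all
    have gc: "g i \<in> carrier X" if "i \<in> I" for i by (rule subsetD[OF Sc[OF that] gS[OF that]])
    have "finsum Y f I = finsum Y (\<lambda>i. q (g i)) I"
      using qY gc fg by (intro Y.M.finsum_cong' refl Pi_I) simp_all
    then have "q (finsum X g I) = \<zero>\<^bsub>Y\<^esub>"
      using qsum[OF gc] conjunct2[OF f] by simp
    then have "p (c (finsum X g I) j) = \<zero>\<^bsub>M\<^esub>" using q0 j by simp
    then have pg: "p (g j) = \<zero>\<^bsub>M\<^esub>" using cE[OF gS refl j] by simp
    have "q (g j) = \<zero>\<^bsub>Y\<^esub>"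
      unfolding q0 using pg p0 cS'[OF j gS[OF j]] by simp
    then show "f j = \<zero>\<^bsub>Y\<^esub>" using fg[OF j] by simp
  qed

  obtain T where T: "\<forall>i\<in>I. T i \<subseteq> q ` S i"
    and TD: "direct_sum_family R Y (insert None (Some ` I)) (case_option (q ` M') T)"
  proof -
    note e = ex[unfolded finite_exchange_def, THEN spec[of _ Y], THEN spec[of _ "q ` M'"],
      THEN spec[of _ "q ` N"], THEN spec[of _ I], THEN spec[of _ "\<lambda>i. q ` S i"], THEN mp]
    show thesis
      by (rule exE[OF e], intro conjI exI[of _ "q \<circ> h"])
        (rule Y.left_module_axioms D1 D2 I D3, (elim conjE, rule that, assumption+)?)+
  qed
  let ?J = "insert None (Some ` I)"
  have J: "finite ?J" using I by simp
  have Tsub: "submodule (case_option (q ` M') T k) R Y" if "k \<in> ?J" for k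
    by (rule TD[unfolded direct_sum_family_def, THEN conjunct1, rule_format, OF that])
  have Ti: "submodule (T i) R Y" if "i \<in> I" for i using Tsub[of "Some i"] that by auto
  note Tiff = Y.direct_sum_family_iff[of ?J "case_option (q ` M') T", OF J Tsub, THEN iffD1, OF _ TD]
  have TE: "\<And>y. y \<in> carrier Y \<Longrightarrow>
      \<exists>f. (\<forall>k\<in>?J. f k \<in> case_option (q ` M') T k) \<and> finsum Y f ?J = y"
    and TU: "\<And>f. (\<forall>k\<in>?J. f k \<in> case_option (q ` M') T k) \<Longrightarrow> finsum Y f ?J = \<zero>\<^bsub>Y\<^esub> \<Longrightarrow>
      (\<forall>k\<in>?J. f k = \<zero>\<^bsub>Y\<^esub>)"
    using Tiff by blast+
  define S' where "S' i = {x \<in> S i. q x \<in> T i}" for i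
  have S'sub: "submodule (S' i) R X" if "i \<in> I" for i
    unfolding S'_def using q.preimage_submodule[OF Ssub Ti] that by blast
  have S'c: "S' i \<subseteq> carrier X" if "i \<in> I" for i using X.submod_sub[OF S'sub[OF that]] .
  have FS: "submodule (case_option M' S' k) R X" if "k \<in> ?J" for k
    using that M'sub S'sub by auto
  have "direct_sum_family R X ?J (case_option M' S')"
  proof (subst X.direct_sum_family_iff[OF J FS], assumption, intro conjI ballI allI impI)
    fix x assume x: "x \<in> carrier X"
    obtain f where f: "\<forall>k\<in>?J. f k \<in> case_option (q ` M') T k" "finsum Y f ?J = q x"
      using TE[OF qY[OF x]] by blast
    obtain m where m: "m \<in> M'" "f None = q m" using f(1) by auto
    have "\<forall>i\<in>I. \<exists>z. z \<in> S i \<and> q z = f (Some i) \<and> q z \<in> T i"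
      using f(1) T by fastforce
    then obtain g where g: "\<And>i. i \<in> I \<Longrightarrow> g i \<in> S i \<and> q (g i) = f (Some i) \<and> q (g i) \<in> T i" by metis
    have gc: "g i \<in> carrier X" if "i \<in> I" for i using g Sc that by blast
    have gs: "finsum X g I \<in> carrier X" using gc by auto
    have mc: "m \<in> carrier X" using m M'c by blast
    have "finsum Y f ?J = f None \<oplus>\<^bsub>Y\<^esub> finsum Y (\<lambda>i. f (Some i)) I"
      using I mc m g gc qY by (intro Y.finsum_option) (auto, metis)
    also have "finsum Y (\<lambda>i. f (Some i)) I = finsum Y (\<lambda>i. q (g i)) I"
      using g gc qY by (intro Y.M.finsum_cong') auto
    also have "f None \<oplus>\<^bsub>Y\<^esub> finsum Y (\<lambda>i. q (g i)) I = q (m \<oplus>\<^bsub>X\<^esub> finsum X g I)"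
      using m mc gs gc qsum[of g] q.add by simp
    finally have qx: "q x = q (m \<oplus>\<^bsub>X\<^esub> finsum X g I)" using f(2) by simp
    define d where "d = x \<ominus>\<^bsub>X\<^esub> (m \<oplus>\<^bsub>X\<^esub> finsum X g I)"
    have dc: "d \<in> carrier X" unfolding d_def using x mc gs by simp
    have qd: "q d = \<zero>\<^bsub>Y\<^esub>" unfolding d_def using qdiff[of x "m \<oplus>\<^bsub>X\<^esub> finsum X g I"] x mc gs qx Y.M.r_neg[OF qY[of x]] by (simp add: a_minus_def)
    have cd: "c d i \<in> S' i" if i: "i \<in> I" for i
    proof -
      have "q (c d i) = \<zero>\<^bsub>Y\<^esub>" using cS'[OF i cS[OF dc i]] q0[of d] q0[of "c d i"] qd p0 i by auto
      then show ?thesis unfolding S'_def using cS[OF dc i] Y.submod_zero[OF Ti[OF i]] by simp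
    qed
    have gS': "g i \<in> S' i" if "i \<in> I" for i using g that unfolding S'_def by blast
    define F where "F = case_option m (\<lambda>i. g i \<oplus>\<^bsub>X\<^esub> c d i)"
    have "\<forall>k\<in>?J. F k \<in> case_option M' S' k"
      using m X.submod_add[OF S'sub] gS' cd by (auto simp: F_def)
    moreover have "finsum X F ?J = x"
    proof -
      have "finsum X F ?J = F None \<oplus>\<^bsub>X\<^esub> finsum X (\<lambda>i. F (Some i)) I"
        using I mc gc cc[OF dc] by (intro X.finsum_option) (auto simp: F_def)
      also have "\<dots> = m \<oplus>\<^bsub>X\<^esub> (finsum X g I \<oplus>\<^bsub>X\<^esub> finsum X (c d) I)"
        unfolding F_def using gc cc[OF dc] by (simp add: X.M.finsum_addf Pi_def)
      also have "\<dots> = m \<oplus>\<^bsub>X\<^esub> finsum X g I \<oplus>\<^bsub>X\<^esub> d" using csum[OF dc] mc gs dc by (simp add: X.M.a_assoc)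
      also have "\<dots> = x" unfolding d_def using x X.M.a_closed[OF mc gs] by (rule X.add_diff_cancel)
      finally show ?thesis .
    qed
    ultimately show "\<exists>f. (\<forall>k\<in>?J. f k \<in> case_option M' S' k) \<and> finsum X f ?J = x" by blast
  next
    fix f k assume f: "(\<forall>k\<in>?J. f k \<in> case_option M' S' k) \<and> finsum X f ?J = \<zero>\<^bsub>X\<^esub>" and k: "k \<in> ?J"
    have fM: "f None \<in> M'" and fS: "\<And>i. i \<in> I \<Longrightarrow> f (Some i) \<in> S' i" using f by auto
    have fMc: "f None \<in> carrier X" using fM M'c by blast
    have fSc: "f (Some i) \<in> carrier X" if "i \<in> I" for i using fS S'c that by blast
    have s: "f None \<oplus>\<^bsub>X\<^esub> finsum X (\<lambda>i. f (Some i)) I = \<zero>\<^bsub>X\<^esub>"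
      using f X.finsum_option[OF I fMc fSc] by simp
    have "finsum Y (\<lambda>k. q (f k)) ?J = q (finsum X f ?J)"
    proof (rule q.sum[OF J, symmetric])
      show "f \<in> ?J \<rightarrow> carrier X" using fMc fSc by blast
    qed
    then have "finsum Y (\<lambda>k. q (f k)) ?J = \<zero>\<^bsub>Y\<^esub>" using f q.zero by simp
    moreover have "\<forall>k\<in>?J. q (f k) \<in> case_option (q ` M') T k"
      using fM fS by (auto simp: S'_def)
    ultimately have "q (f None) = \<zero>\<^bsub>Y\<^esub>" using TU[of "\<lambda>k. q (f k)"] by blast
    then have n0: "f None = \<zero>\<^bsub>X\<^esub>" using qN[OF fMc] fM MN0 by blast
    have "finsum X (\<lambda>i. f (Some i)) I \<in> carrier X" using fSc by auto
    then have "finsum X (\<lambda>i. f (Some i)) I = \<zero>\<^bsub>X\<^esub>" using s n0 by simp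
    moreover have "\<And>i. i \<in> I \<Longrightarrow> f (Some i) \<in> S i" using fS unfolding S'_def by blast
    ultimately have "\<And>i. i \<in> I \<Longrightarrow> f (Some i) = \<zero>\<^bsub>X\<^esub>"
      using cE[of "\<lambda>i. f (Some i)" "\<zero>\<^bsub>X\<^esub>"] c0 by simp
    then show "f k = \<zero>\<^bsub>X\<^esub>" using k n0 by auto
  qed
  moreover have "\<forall>i\<in>I. S' i \<subseteq> S i" unfolding S'_def by blast
  ultimately show "\<exists>S'. (\<forall>i\<in>I. S' i \<subseteq> S i) \<and>
      direct_sum_family R X (insert None (Some ` I)) (case_option M' S')" by blast
qed

end

theory Submission
  imports Defs "HOL-Library.Multiset"
begin

text \<open>
  Everything is done up to small submodules: \<open>X \<approx> Y\<close> means that each of \<open>X\<close>, \<open>Y\<close> is contained in the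
  other plus a small submodule.  If \<open>A \<approx> A'\<close> are summands, then \<open>A\<close> and \<open>A'\<close> have the same
  complements.  Any two summands can be put in good position: there is a decomposition
  \<open>M = I \<oplus> A1 \<oplus> Y \<oplus> Q\<close> with \<open>B = I \<oplus> Y\<close> and \<open>A \<approx> I \<oplus> A1\<close>, as for subspaces of a vector space, and
  the isomorphism types of \<open>A1\<close> and \<open>Y\<close> do not depend on the choices.  If \<open>A1\<close> and \<open>Y\<close> are isomorphic,
  then \<open>Q\<close> plus the graph of an isomorphism is a common complement of \<open>A\<close> and \<open>B\<close>.  The two
  perspectivities embed \<open>A1\<close> and \<open>Y\<close> as summands into each other, and the Schroeder-Bernstein
  argument applies because the union of an increasing sequence of summands is again a summand.
\<close>

section \<open>Submodules and internal direct sums with two terms\<close>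

context left_module
begin

abbreviation sm :: "'b set \<Rightarrow> bool"
  where "sm X \<equiv> submodule X R M"

abbreviation subsum :: "'b set \<Rightarrow> 'b set \<Rightarrow> 'b set"  (infixl "\<boxplus>" 65)
  where "X \<boxplus> Y \<equiv> X <+>\<^bsub>M\<^esub> Y"

abbreviation sub_iso :: "'b set \<Rightarrow> 'b set \<Rightarrow> ('b \<Rightarrow> 'b) set"
  where "sub_iso X Y \<equiv> module_iso R (M\<lparr>carrier := X\<rparr>) (M\<lparr>carrier := Y\<rparr>)"

definition isomorphic :: "'b set \<Rightarrow> 'b set \<Rightarrow> bool"  (infix "\<cong>\<^sub>M" 50)
  where "X \<cong>\<^sub>M Y \<longleftrightarrow> sub_iso X Y \<noteq> {}"

text \<open>The total \<open>Z\<close> is a parameter, unlike in \<open>direct_sum\<close>, so that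
  decompositions of submodules can be stated inside the one module \<open>M\<close>, without
  changing carriers.\<close>

definition dsum :: "'b set \<Rightarrow> 'b set \<Rightarrow> 'b set \<Rightarrow> bool"
  where "dsum X Y Z \<longleftrightarrow> sm X \<and> sm Y \<and> X \<boxplus> Y = Z \<and> X \<inter> Y = {\<zero>\<^bsub>M\<^esub>}"

abbreviation summand :: "'b set \<Rightarrow> bool"
  where "summand X \<equiv> direct_summand R M X"

abbreviation small :: "'b set \<Rightarrow> bool"
  where "small X \<equiv> small_submodule R M X"

lemma submod_carrier: "sm X \<Longrightarrow> x \<in> X \<Longrightarrow> x \<in> carrier M"
  using submod_sub by blast

lemma submodI_smult:
  assumes "H \<subseteq> carrier M" "\<zero>\<^bsub>M\<^esub> \<in> H"
    "\<And>x y. x \<in> H \<Longrightarrow> y \<in> H \<Longrightarrow> x \<oplus>\<^bsub>M\<^esub> y \<in> H"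
    "\<And>a x. a \<in> carrier R \<Longrightarrow> x \<in> H \<Longrightarrow> a \<odot>\<^bsub>M\<^esub> x \<in> H"
  shows "sm H"
proof (rule submodI)
  fix x assume x: "x \<in> H"
  then have xc: "x \<in> carrier M" using assms(1) by blast
  have "(\<ominus>\<^bsub>R\<^esub> \<one>\<^bsub>R\<^esub>) \<odot>\<^bsub>M\<^esub> x \<oplus>\<^bsub>M\<^esub> \<one>\<^bsub>R\<^esub> \<odot>\<^bsub>M\<^esub> x = (\<ominus>\<^bsub>R\<^esub> \<one>\<^bsub>R\<^esub> \<oplus>\<^bsub>R\<^esub> \<one>\<^bsub>R\<^esub>) \<odot>\<^bsub>M\<^esub> x"
    using xc by (intro smult_l_distr[symmetric]) auto
  also have "\<dots> = \<zero>\<^bsub>R\<^esub> \<odot>\<^bsub>M\<^esub> x" by (simp add: R.l_neg)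
  also have "\<dots> = \<zero>\<^bsub>M\<^esub>"
  proof -
    have "\<zero>\<^bsub>R\<^esub> \<odot>\<^bsub>M\<^esub> x \<oplus>\<^bsub>M\<^esub> \<zero>\<^bsub>R\<^esub> \<odot>\<^bsub>M\<^esub> x = \<zero>\<^bsub>R\<^esub> \<odot>\<^bsub>M\<^esub> x"
      using smult_l_distr[of "\<zero>\<^bsub>R\<^esub>" "\<zero>\<^bsub>R\<^esub>" x] xc by simp
    then show ?thesis using xc by (metis M.add.r_cancel_one' R.zero_closed smult_closed)
  qed
  finally have "(\<ominus>\<^bsub>R\<^esub> \<one>\<^bsub>R\<^esub>) \<odot>\<^bsub>M\<^esub> x = \<ominus>\<^bsub>M\<^esub> x"
    using xc by (intro M.minus_equality[symmetric]) auto
  then show "\<ominus>\<^bsub>M\<^esub> x \<in> H" using assms(4)[of "\<ominus>\<^bsub>R\<^esub> \<one>\<^bsub>R\<^esub>" x] x by simp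
qed (use assms in auto)

lemma mem_sumI: "x \<in> X \<Longrightarrow> y \<in> Y \<Longrightarrow> x \<oplus>\<^bsub>M\<^esub> y \<in> X \<boxplus> Y"
  unfolding set_add_def set_mult_def by auto

lemma mem_sumE:
  assumes "z \<in> X \<boxplus> Y"
  obtains x y where "x \<in> X" "y \<in> Y" "z = x \<oplus>\<^bsub>M\<^esub> y"
  using assms unfolding set_add_def set_mult_def by auto

lemma sm_zero: "sm {\<zero>\<^bsub>M\<^esub>}"
  by (rule submodI_smult) (auto simp: smult_r_zero)

lemma sm_sum:
  assumes "sm X" "sm Y" shows "sm (X \<boxplus> Y)"
proof (rule submodI_smult)
  show "X \<boxplus> Y \<subseteq> carrier M"
    using assms by (auto elim!: mem_sumE dest: submod_carrier)
  show "\<zero>\<^bsub>M\<^esub> \<in> X \<boxplus> Y"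
    using mem_sumI[OF submod_zero[OF assms(1)] submod_zero[OF assms(2)]] by simp
  fix u v assume "u \<in> X \<boxplus> Y" "v \<in> X \<boxplus> Y"
  then obtain x y x' y' where *: "x \<in> X" "y \<in> Y" "u = x \<oplus>\<^bsub>M\<^esub> y"
    "x' \<in> X" "y' \<in> Y" "v = x' \<oplus>\<^bsub>M\<^esub> y'" by (auto elim!: mem_sumE)
  then have "u \<oplus>\<^bsub>M\<^esub> v = (x \<oplus>\<^bsub>M\<^esub> x') \<oplus>\<^bsub>M\<^esub> (y \<oplus>\<^bsub>M\<^esub> y')"
    using submod_carrier[OF assms(1)] submod_carrier[OF assms(2)] by (simp add: M.a_ac)
  then show "u \<oplus>\<^bsub>M\<^esub> v \<in> X \<boxplus> Y"
    using * mem_sumI submod_add assms by metis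
next
  fix a u assume a: "a \<in> carrier R" and "u \<in> X \<boxplus> Y"
  then obtain x y where *: "x \<in> X" "y \<in> Y" "u = x \<oplus>\<^bsub>M\<^esub> y" by (auto elim!: mem_sumE)
  then have "a \<odot>\<^bsub>M\<^esub> u = a \<odot>\<^bsub>M\<^esub> x \<oplus>\<^bsub>M\<^esub> a \<odot>\<^bsub>M\<^esub> y"
    using submod_carrier[OF assms(1)] submod_carrier[OF assms(2)] a smult_r_distr by simp
  then show "a \<odot>\<^bsub>M\<^esub> u \<in> X \<boxplus> Y"
    using * a mem_sumI submod_smult assms by metis
qed

lemma sm_Int:
  assumes "sm X" "sm Y" shows "sm (X \<inter> Y)"
  using assms submod_sub[OF assms(1)]
  by (intro submodI_smult) (auto intro: submod_zero submod_add submod_smult)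

lemma sum_upper1: "sm X \<Longrightarrow> sm Y \<Longrightarrow> X \<subseteq> X \<boxplus> Y"
  using mem_sumI[of _ X "\<zero>\<^bsub>M\<^esub>" Y] submod_zero submod_carrier by fastforce

lemma sum_upper2: "sm X \<Longrightarrow> sm Y \<Longrightarrow> Y \<subseteq> X \<boxplus> Y"
  using mem_sumI[of "\<zero>\<^bsub>M\<^esub>" X _ Y] submod_zero submod_carrier by fastforce

lemma sum_least: "sm Z \<Longrightarrow> X \<subseteq> Z \<Longrightarrow> Y \<subseteq> Z \<Longrightarrow> X \<boxplus> Y \<subseteq> Z"
  by (auto elim!: mem_sumE intro: submod_add)

lemma sum_mono: "X \<subseteq> X' \<Longrightarrow> Y \<subseteq> Y' \<Longrightarrow> X \<boxplus> Y \<subseteq> X' \<boxplus> Y'"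
  by (auto elim!: mem_sumE intro!: mem_sumI)

lemma sum_comm: "sm X \<Longrightarrow> sm Y \<Longrightarrow> X \<boxplus> Y = Y \<boxplus> X"
  by (simp add: sm_sum subset_antisym sum_least sum_upper1 sum_upper2)

lemma sum_assoc:
  assumes "sm X" "sm Y" "sm Z" shows "X \<boxplus> Y \<boxplus> Z = X \<boxplus> (Y \<boxplus> Z)"
proof -
  note s = assms sm_sum[OF assms(1,2)] sm_sum[OF assms(2,3)]
  have "X \<subseteq> X \<boxplus> (Y \<boxplus> Z)" "Y \<boxplus> Z \<subseteq> X \<boxplus> (Y \<boxplus> Z)" "Y \<subseteq> Y \<boxplus> Z" "Z \<subseteq> Y \<boxplus> Z"
    "X \<subseteq> X \<boxplus> Y" "Y \<subseteq> X \<boxplus> Y" "X \<boxplus> Y \<subseteq> X \<boxplus> Y \<boxplus> Z" "Z \<subseteq> X \<boxplus> Y \<boxplus> Z"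
    by (simp_all add: s sum_upper1 sum_upper2)
  then show ?thesis
    by (intro subset_antisym sum_least sm_sum s) auto
qed

lemma sum_absorb: "sm X \<Longrightarrow> sm Y \<Longrightarrow> X \<subseteq> Y \<Longrightarrow> X \<boxplus> Y = Y"
  by (simp add: subset_antisym sum_least sum_upper2)

lemma sum_zero: "sm X \<Longrightarrow> X \<boxplus> {\<zero>\<^bsub>M\<^esub>} = X"
  using sum_absorb[of "{\<zero>\<^bsub>M\<^esub>}" X] sum_comm[of X "{\<zero>\<^bsub>M\<^esub>}"] sm_zero submod_zero by auto

lemma modular_law:
  assumes "sm X" "sm Y" "sm Z" "X \<subseteq> Z"
  shows "(X \<boxplus> Y) \<inter> Z = X \<boxplus> (Y \<inter> Z)"
proof (intro subset_antisym subsetI)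
  fix z assume "z \<in> (X \<boxplus> Y) \<inter> Z"
  then obtain x y where *: "x \<in> X" "y \<in> Y" "z = x \<oplus>\<^bsub>M\<^esub> y" "z \<in> Z" by (auto elim!: mem_sumE)
  then have c: "x \<in> carrier M" "y \<in> carrier M" using assms submod_carrier by auto
  have "y = z \<ominus>\<^bsub>M\<^esub> x"
    using c M.r_neg1[of x y] * M.a_comm[of x y] by (simp add: a_minus_def M.a_assoc M.r_neg)
  moreover have "z \<ominus>\<^bsub>M\<^esub> x \<in> Z" using * assms(3,4) submod_diff by blast
  ultimately have "y \<in> Z" by simp
  then show "z \<in> X \<boxplus> (Y \<inter> Z)" using * mem_sumI by auto
next
  fix z assume "z \<in> X \<boxplus> (Y \<inter> Z)"
  then show "z \<in> (X \<boxplus> Y) \<inter> Z"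
    using assms by (auto elim!: mem_sumE intro: mem_sumI submod_add)
qed

lemma dsumD:
  assumes "dsum X Y Z"
  shows "sm X" "sm Y" "sm Z" "X \<boxplus> Y = Z" "X \<inter> Y = {\<zero>\<^bsub>M\<^esub>}" "X \<subseteq> Z" "Y \<subseteq> Z"
  using assms sum_upper1[of X Y] sum_upper2[of X Y] sm_sum[of X Y] unfolding dsum_def by simp_all

lemma dsumI:
  assumes "sm X" "sm Y" "X \<boxplus> Y = Z" "X \<inter> Y \<subseteq> {\<zero>\<^bsub>M\<^esub>}"
  shows "dsum X Y Z"
  using assms submod_zero unfolding dsum_def by blast

lemma direct_sum_iff: "direct_sum R M X Y \<longleftrightarrow> dsum X Y (carrier M)"
  unfolding direct_sum_def dsum_def by blast

lemma summandI: "dsum X Y (carrier M) \<Longrightarrow> summand X"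
  unfolding direct_summand_def direct_sum_iff by blast

lemma dsum_comm: "dsum X Y Z \<Longrightarrow> dsum Y X Z"
  unfolding dsum_def by (auto simp: sum_comm)

lemma summandI2: "dsum X Y (carrier M) \<Longrightarrow> summand Y"
  using dsum_comm summandI by blast

lemma summandE:
  assumes "summand X" obtains Y where "dsum X Y (carrier M)"
  using assms unfolding direct_summand_def direct_sum_iff by blast

lemma summand_sm: "summand X \<Longrightarrow> sm X"
  unfolding direct_summand_def direct_sum_def by blast

lemma dsum_zero: "sm X \<Longrightarrow> dsum X {\<zero>\<^bsub>M\<^esub>} X"
  using submod_zero by (intro dsumI) (auto simp: sum_zero sm_zero)

text \<open>The modular law. It turns the complements in \<open>M\<close> supplied by
  \<open>D1\<close> and \<open>D3\<close> into complements inside smaller submodules.\<close>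

lemma dsum_restrict:
  assumes "dsum X Y Z" "sm B" "X \<subseteq> B" "B \<subseteq> Z"
  shows "dsum X (B \<inter> Y) B"
proof (rule dsumI)
  note d = dsumD[OF assms(1)]
  show "sm X" "sm (B \<inter> Y)" using d assms sm_Int by auto
  have "(X \<boxplus> Y) \<inter> B = X \<boxplus> (Y \<inter> B)" using modular_law d assms by blast
  then show "X \<boxplus> (B \<inter> Y) = B" using d(4) assms(4) by (simp add: Int_absorb1 Int_commute[of B])
  show "X \<inter> (B \<inter> Y) \<subseteq> {\<zero>\<^bsub>M\<^esub>}" using d by blast
qed

text \<open>What needs an argument is that \<open>X\<close> misses \<open>Y \<boxplus> W\<close>. As
  \<open>W\<close> misses \<open>V\<close>, the modular law gives
  \<open>(Y \<boxplus> W) \<inter> V = Y\<close>, and \<open>X\<close> is contained in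
  \<open>V\<close>.\<close>

lemma dsum_assoc:
  assumes "dsum X Y V" "dsum V W Z"
  shows "dsum Y W (Y \<boxplus> W)" "dsum X (Y \<boxplus> W) Z"
proof -
  note a = dsumD[OF assms(1)] and b = dsumD[OF assms(2)]
  show "dsum Y W (Y \<boxplus> W)" using a b by (intro dsumI) auto
  show "dsum X (Y \<boxplus> W) Z"
  proof (rule dsumI)
    show "X \<boxplus> (Y \<boxplus> W) = Z" using a b sum_assoc by metis
    have "(Y \<boxplus> W) \<inter> V = Y \<boxplus> (W \<inter> V)" using modular_law a b by blast
    also have "\<dots> = Y" using b(5) a sum_zero by (simp add: Int_commute)
    finally show "X \<inter> (Y \<boxplus> W) \<subseteq> {\<zero>\<^bsub>M\<^esub>}" using a by blast
  qed (use a b sm_sum in auto)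
qed

lemma dsum_assoc':
  assumes "dsum X V Z" "dsum Y W V"
  shows "dsum X Y (X \<boxplus> Y)" "dsum (X \<boxplus> Y) W Z"
proof -
  have "Y \<boxplus> X = X \<boxplus> Y" using dsumD(1)[OF assms(1)] dsumD(1)[OF assms(2)] by (rule sum_comm[symmetric])
  then show "dsum X Y (X \<boxplus> Y)" "dsum (X \<boxplus> Y) W Z"
    using dsum_assoc[OF dsum_comm[OF assms(2)] dsum_comm[OF assms(1)]] by (simp_all add: dsum_comm)
qed

section \<open>Direct sums of finitely many submodules, given as lists\<close>

fun dsums :: "'b set list \<Rightarrow> 'b set \<Rightarrow> bool"
  where "dsums [] Z \<longleftrightarrow> Z = {\<zero>\<^bsub>M\<^esub>}"
  | "dsums (X # Xs) Z \<longleftrightarrow> (\<exists>V. dsums Xs V \<and> dsum X V Z)"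

lemma dsums_sm: "dsums Xs Z \<Longrightarrow> sm Z"
  by (cases Xs) (auto simp: sm_zero dest: dsumD)

lemma dsum_zero_left: "dsum {\<zero>\<^bsub>M\<^esub>} W Z \<longleftrightarrow> W = Z \<and> sm Z"
proof
  assume d: "dsum {\<zero>\<^bsub>M\<^esub>} W Z"
  then show "W = Z \<and> sm Z"
    using dsumD(3,4)[OF dsum_comm[OF d]] dsumD(2)[OF d] sum_zero by simp
qed (simp add: dsum_comm dsum_zero)

lemma dsums_append: "dsums (Xs @ Ys) Z \<longleftrightarrow> (\<exists>V W. dsums Xs V \<and> dsums Ys W \<and> dsum V W Z)"
proof (induction Xs arbitrary: Z)
  case Nil
  show ?case using dsums_sm dsum_zero_left by auto
next
  case (Cons X Xs)
  show ?case
  proof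
    assume "dsums ((X # Xs) @ Ys) Z"
    then obtain U V W where "dsum X U Z" "dsum V W U" "dsums Xs V" "dsums Ys W"
      using Cons.IH by auto
    then show "\<exists>V W. dsums (X # Xs) V \<and> dsums Ys W \<and> dsum V W Z"
      using dsum_assoc'[of X U Z V W] by auto
  next
    assume "\<exists>V W. dsums (X # Xs) V \<and> dsums Ys W \<and> dsum V W Z"
    then obtain U V W where "dsum X U V" "dsum V W Z" "dsums Xs U" "dsums Ys W" by auto
    then show "dsums ((X # Xs) @ Ys) Z"
      using dsum_assoc[of X U V W Z] Cons.IH by auto
  qed
qed

lemma dsums_swap:
  assumes "dsums (X # Y # Xs) Z" shows "dsums (Y # X # Xs) Z"
proof -
  obtain U V where "dsums Xs U" "dsum Y U V" "dsum X V Z" using assms by auto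
  then show ?thesis using dsum_assoc'[of X V Z Y U] dsum_assoc[of Y X "X \<boxplus> Y" U Z]
    by (auto dest: dsum_comm)
qed

lemma dsums_rotate_in: "dsums (X # Ys @ Zs) Z \<Longrightarrow> dsums (Ys @ X # Zs) Z"
proof (induction Ys arbitrary: Z)
  case (Cons Y Ys)
  then show ?case using dsums_swap[of X Y "Ys @ Zs" Z] by auto
qed simp

text \<open>Induction on \<open>Xs\<close>: the head is located in \<open>Ys\<close> and moved there
  by adjacent swaps. Later proofs regroup decompositions with four or five terms in this
  way.\<close>

lemma dsums_perm: "dsums Xs Z \<Longrightarrow> mset Xs = mset Ys \<Longrightarrow> dsums Ys Z"
proof (induction Xs arbitrary: Ys Z)
  case (Cons X Xs)
  then have "X \<in> set Ys" by (metis list.set_intros(1) set_mset_mset)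
  then obtain As Bs where Ys: "Ys = As @ X # Bs" by (meson split_list)
  then have "mset Xs = mset (As @ Bs)" using Cons.prems(2) by simp
  then have "dsums (X # As @ Bs) Z" using Cons.IH[of _ "As @ Bs"] Cons.prems(1) by auto
  then show ?case using dsums_rotate_in Ys by metis
qed simp

lemma dsums_1: "dsums [X] Z \<longleftrightarrow> X = Z \<and> sm Z"
  using dsum_zero_left[of X Z] dsum_comm by auto

lemma dsums_2: "dsums [X, Y] Z \<longleftrightarrow> dsum X Y Z"
  unfolding dsums.simps(2)[of X "[Y]"] dsums_1 by (auto dest: dsumD)

text \<open>Fuses the first two terms into one summand; after \<open>dsums_perm\<close> this can be
  done with any two terms.\<close>

lemma dsums_Cons2:
  "dsums (X # Y # Xs) Z \<longleftrightarrow> (\<exists>V. dsums Xs V \<and> dsum X Y (X \<boxplus> Y) \<and> dsum (X \<boxplus> Y) V Z)"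
  using dsums_append[of "[X, Y]" Xs Z] dsumD(4) unfolding append.simps dsums_2 by blast

section \<open>Small submodules\<close>

lemma small_sm: "small S \<Longrightarrow> sm S"
  unfolding small_submodule_def by blast

lemma smallD: "small S \<Longrightarrow> sm T \<Longrightarrow> S \<boxplus> T = carrier M \<Longrightarrow> T = carrier M"
  unfolding small_submodule_def by blast

lemma smallI: "sm S \<Longrightarrow> (\<And>T. sm T \<Longrightarrow> S \<boxplus> T = carrier M \<Longrightarrow> T = carrier M) \<Longrightarrow> small S"
  unfolding small_submodule_def by blast

lemma small_zero: "small {\<zero>\<^bsub>M\<^esub>}"
  using sum_zero sum_comm sm_zero by (intro smallI) auto

lemma small_subset:
  assumes "small S" "sm T" "T \<subseteq> S" shows "small T"
proof (rule smallI[OF assms(2)])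
  fix U assume U: "sm U" "T \<boxplus> U = carrier M"
  then have "S \<boxplus> U = carrier M"
    using sum_mono[OF assms(3) order.refl, of U] submod_sub[OF sm_sum[OF small_sm[OF assms(1)] U(1)]]
    by auto
  then show "U = carrier M" using assms(1) U(1) smallD by blast
qed

lemma small_sum:
  assumes "small S" "small T" shows "small (S \<boxplus> T)"
proof (rule smallI)
  show "sm (S \<boxplus> T)" using assms small_sm sm_sum by blast
  fix U assume "sm U" "S \<boxplus> T \<boxplus> U = carrier M"
  then show "U = carrier M"
    using assms smallD small_sm sm_sum sum_assoc by metis
qed

text \<open>\<open>(S \<boxplus> A) \<inter> C\<close> is the projection of \<open>S\<close> to
  \<open>C\<close> along \<open>A\<close>, so this is the fact that homomorphic images of small
  submodules are small, argued in the lattice of submodules.\<close>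

lemma small_proj:
  assumes "dsum A C (carrier M)" "small S"
  shows "small ((S \<boxplus> A) \<inter> C)"
proof (rule smallI)
  note d = dsumD[OF assms(1)] and s = small_sm[OF assms(2)]
  let ?P = "(S \<boxplus> A) \<inter> C"
  show P: "sm ?P" using d s sm_sum sm_Int by auto
  fix T assume T: "sm T" "?P \<boxplus> T = carrier M"
  have TC: "sm (T \<inter> C)" using T d sm_Int by auto
  \<comment> \<open>If \<open>T\<close> and \<open>?P\<close> fill \<open>M\<close>, then
    \<open>T \<inter> C\<close> and \<open>?P\<close> fill \<open>C\<close>. Since \<open>?P\<close>
    lies in \<open>S \<boxplus> A\<close>, it follows that \<open>S\<close>, \<open>A\<close> and
    \<open>T \<inter> C\<close> fill \<open>M\<close>.\<close>
  have "C = (?P \<boxplus> T) \<inter> C" using T(2) d(7) by blast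
  also have "\<dots> = ?P \<boxplus> (T \<inter> C)" using P T d by (intro modular_law) auto
  finally have C: "C = ?P \<boxplus> (T \<inter> C)" .
  have "S \<boxplus> (A \<boxplus> (T \<inter> C)) = carrier M"
  proof (rule subset_antisym)
    have sA: "sm (A \<boxplus> (T \<inter> C))" "sm (S \<boxplus> (A \<boxplus> (T \<inter> C)))" using s d TC sm_sum by auto
    then show "S \<boxplus> (A \<boxplus> (T \<inter> C)) \<subseteq> carrier M" using submod_sub by auto
    have SA: "S \<boxplus> A \<subseteq> S \<boxplus> (A \<boxplus> (T \<inter> C))" using d TC by (intro sum_mono sum_upper1) auto
    have TC': "A \<boxplus> (T \<inter> C) \<subseteq> S \<boxplus> (A \<boxplus> (T \<inter> C))" using s sA by (intro sum_upper2)
    have "C \<subseteq> S \<boxplus> (A \<boxplus> (T \<inter> C))"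
      using SA TC' sum_upper2[OF d(1) TC] by (subst C, intro sum_least[OF sA(2)]) auto
    moreover have "A \<subseteq> S \<boxplus> (A \<boxplus> (T \<inter> C))" using TC' sum_upper1[OF d(1) TC] by auto
    ultimately show "carrier M \<subseteq> S \<boxplus> (A \<boxplus> (T \<inter> C))" using sum_least[OF sA(2)] d(4) by metis
  qed
  \<comment> \<open>Smallness of \<open>S\<close> removes it from the sum; what is left forces
    \<open>T \<inter> C\<close> to be all of \<open>C\<close>, by the modular law.\<close>
  then have AT: "A \<boxplus> (T \<inter> C) = carrier M" using assms(2) smallD sm_sum[OF d(1) TC] by blast
  have "C = ((T \<inter> C) \<boxplus> A) \<inter> C" using AT sum_comm[OF d(1) TC] d(7) by auto
  also have "\<dots> = (T \<inter> C) \<boxplus> (A \<inter> C)" using TC d by (intro modular_law) auto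
  also have "\<dots> = T \<inter> C" using sum_zero[OF TC] d(5) by simp
  finally have "C \<subseteq> T" by blast
  then have "?P \<subseteq> T" by blast
  then show "T = carrier M" using T sum_absorb[OF P T(1)] by simp
qed

section \<open>Inclusion and equality up to small submodules\<close>

definition le_small :: "'b set \<Rightarrow> 'b set \<Rightarrow> bool"  (infix "\<lesssim>" 50)
  where "X \<lesssim> Y \<longleftrightarrow> (\<exists>S. small S \<and> X \<subseteq> Y \<boxplus> S)"

definition eq_small :: "'b set \<Rightarrow> 'b set \<Rightarrow> bool"  (infix "\<approx>" 50)
  where "X \<approx> Y \<longleftrightarrow> X \<lesssim> Y \<and> Y \<lesssim> X"

lemma le_smallI: "small S \<Longrightarrow> X \<subseteq> Y \<boxplus> S \<Longrightarrow> X \<lesssim> Y"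
  unfolding le_small_def by blast

lemma subset_le_small: "sm Y \<Longrightarrow> X \<subseteq> Y \<Longrightarrow> X \<lesssim> Y"
  by (rule le_smallI[OF small_zero]) (simp add: sum_zero)

lemma le_small_trans:
  assumes "X \<lesssim> Y" "Y \<lesssim> Z" "sm Z" shows "X \<lesssim> Z"
proof -
  obtain S T where S: "small S" "X \<subseteq> Y \<boxplus> S" "small T" "Y \<subseteq> Z \<boxplus> T"
    using assms unfolding le_small_def by blast
  have "X \<subseteq> (Z \<boxplus> T) \<boxplus> S" using S(2) sum_mono[OF S(4) order.refl] by blast
  then have "X \<subseteq> Z \<boxplus> (T \<boxplus> S)" using sum_assoc assms(3) S small_sm by auto
  then show ?thesis using le_smallI small_sum S by blast
qed

lemma le_small_sum:
  assumes "X \<lesssim> Z" "Y \<lesssim> Z" "sm Z" shows "X \<boxplus> Y \<lesssim> Z"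
proof -
  obtain S T where S: "small S" "X \<subseteq> Z \<boxplus> S" "small T" "Y \<subseteq> Z \<boxplus> T"
    using assms unfolding le_small_def by blast
  have s: "sm S" "sm T" using S small_sm by auto
  have "Z \<boxplus> S \<subseteq> Z \<boxplus> (S \<boxplus> T)" "Z \<boxplus> T \<subseteq> Z \<boxplus> (S \<boxplus> T)"
    using sum_upper1[OF s] sum_upper2[OF s] by (simp_all add: sum_mono)
  then have "X \<boxplus> Y \<subseteq> Z \<boxplus> (S \<boxplus> T)"
    using S s assms(3) by (intro sum_least sm_sum) auto
  then show ?thesis using le_smallI small_sum S by blast
qed

lemma eq_small_refl: "sm X \<Longrightarrow> X \<approx> X"
  unfolding eq_small_def by (simp add: subset_le_small)

lemma eq_small_sym: "X \<approx> Y \<Longrightarrow> Y \<approx> X"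
  unfolding eq_small_def by simp

lemma eq_small_trans: "X \<approx> Y \<Longrightarrow> Y \<approx> Z \<Longrightarrow> sm X \<Longrightarrow> sm Z \<Longrightarrow> X \<approx> Z"
  unfolding eq_small_def using le_small_trans by blast

lemma eq_small_sum:
  assumes "X \<approx> X'" "Y \<approx> Y'" "sm X" "sm X'" "sm Y" "sm Y'"
  shows "X \<boxplus> Y \<approx> X' \<boxplus> Y'"
proof -
  have le: "U \<boxplus> V \<lesssim> U' \<boxplus> V'" if "U \<lesssim> U'" "V \<lesssim> V'" "sm U'" "sm V'" for U V U' V'
  proof (rule le_small_sum)
    show "sm (U' \<boxplus> V')" using that sm_sum by blast
    then show "U \<lesssim> U' \<boxplus> V'" "V \<lesssim> U' \<boxplus> V'"
      using that le_small_trans subset_le_small sum_upper1 sum_upper2 by metis+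
  qed
  then show ?thesis using assms unfolding eq_small_def by blast
qed

end

section \<open>Summands of a quasi-discrete module\<close>

locale quasi_discrete_module = left_module +
  assumes quasi_discrete: "quasi_discrete R M"
begin

lemma D1:
  assumes "sm A"
  obtains P Q where "dsum P Q (carrier M)" "P \<subseteq> A" "small (A \<inter> Q)"
  using quasi_discrete assms unfolding quasi_discrete_def cond_D1_def direct_sum_iff by blast

lemma D3: "summand X \<Longrightarrow> summand Y \<Longrightarrow> X \<boxplus> Y = carrier M \<Longrightarrow> summand (X \<inter> Y)"
  using quasi_discrete unfolding quasi_discrete_def cond_D3_def by blast

text \<open>\<open>D3\<close> makes the intersection a summand. It is small as well, so its
  complement is already all of \<open>M\<close> and the intersection is zero.\<close>

lemma dsum_if_small_Int:
  assumes "summand X" "summand Y" "X \<boxplus> Y = carrier M" "X \<inter> Y \<subseteq> S" "small S"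
  shows "dsum X Y (carrier M)"
proof -
  have s: "sm X" "sm Y" using assms summand_sm by auto
  obtain L where L: "dsum (X \<inter> Y) L (carrier M)" using D3 assms summandE by metis
  have "small (X \<inter> Y)" using small_subset assms sm_Int s by blast
  then have "L = carrier M" using smallD dsumD[OF L] by blast
  then have "X \<inter> Y = {\<zero>\<^bsub>M\<^esub>}" using dsumD(5,6)[OF L] by blast
  then show ?thesis using dsumI s assms(3) by blast
qed

text \<open>The two halves of \<open>A \<approx> A'\<close> serve different ends. From
  \<open>A \<subseteq> A' \<boxplus> S\<close> it follows that \<open>A'\<close> and
  \<open>C\<close> fill \<open>M\<close> once the small \<open>S\<close> is dropped. From
  \<open>A' \<subseteq> A \<boxplus> T\<close> it follows that \<open>A' \<inter> C\<close> lies in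
  the projection of \<open>T\<close> to \<open>C\<close>, which is small.\<close>

lemma dsum_eq_small:
  assumes "A \<approx> A'" "summand A'" "dsum A C (carrier M)"
  shows "dsum A' C (carrier M)"
proof -
  note d = dsumD[OF assms(3)] and s' = summand_sm[OF assms(2)]
  obtain S where S: "small S" "A \<subseteq> A' \<boxplus> S" using assms(1) unfolding eq_small_def le_small_def by blast
  obtain T where T: "small T" "A' \<subseteq> A \<boxplus> T" using assms(1) unfolding eq_small_def le_small_def by blast
  have sST: "sm S" "sm T" using S T small_sm by auto
  have AC: "sm (A' \<boxplus> C)" using s' d sm_sum by blast
  have "A' \<boxplus> S \<subseteq> S \<boxplus> (A' \<boxplus> C)"
    unfolding sum_comm[OF s' sST(1)] using s' d by (intro sum_mono sum_upper1) auto
  moreover have "C \<subseteq> S \<boxplus> (A' \<boxplus> C)"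
    using sum_upper2[OF s' d(2)] sum_upper2[OF sST(1) AC] by blast
  ultimately have "A \<boxplus> C \<subseteq> S \<boxplus> (A' \<boxplus> C)" using S(2) by (intro sum_least sm_sum[OF sST(1) AC]) auto
  then have "S \<boxplus> (A' \<boxplus> C) = carrier M" using d(4) submod_sub[OF sm_sum[OF sST(1) AC]] by blast
  then have "A' \<boxplus> C = carrier M" using smallD S AC by blast
  moreover have "A' \<inter> C \<subseteq> (T \<boxplus> A) \<inter> C" using T(2) sum_comm[OF d(1) sST(2)] by blast
  ultimately show ?thesis
    using small_proj[OF assms(3) T(1)] assms(2) summandI2[OF assms(3)] by (intro dsum_if_small_Int)
qed

text \<open>An exchange argument: \<open>I\<close> lies in \<open>A\<close> up to the small
  \<open>S\<close>, so it can take the place of a summand \<open>A0\<close> of \<open>A\<close>. If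
  \<open>A1\<close> is the rest of \<open>A\<close>, the complement \<open>A1 \<boxplus> K\<close>
  of \<open>A0\<close> is a complement of \<open>I\<close> too.\<close>

lemma summand_replace:
  assumes AK: "dsum A K (carrier M)" and I: "summand I"
    and S: "small S" "S \<subseteq> K" "I \<subseteq> A \<boxplus> S"
  obtains A1 where "A1 \<subseteq> A" "dsum A1 K (A1 \<boxplus> K)" "dsum I (A1 \<boxplus> K) (carrier M)" "I \<boxplus> A1 \<approx> A"
proof -
  note d = dsumD[OF AK] and sI = summand_sm[OF I] and sS = small_sm[OF S(1)]
  have IS: "sm (I \<boxplus> S)" using sI sS sm_sum by blast
  \<comment> \<open>Because \<open>S\<close> lies in \<open>K\<close>, this is the projection of
    \<open>I\<close> to \<open>A\<close> along \<open>K\<close>. \<open>D1\<close> yields a summand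
    \<open>A0\<close> inside \<open>T\<close> that exhausts \<open>T\<close> up to a small
    submodule.\<close>
  define T where "T = (I \<boxplus> S) \<inter> A"
  have sT: "sm T" unfolding T_def using IS d sm_Int by blast
  obtain A0 L where L: "dsum A0 L (carrier M)" "A0 \<subseteq> T" "small (T \<inter> L)" using D1[OF sT] .
  define A1 where "A1 = A \<inter> L"
  have A01: "dsum A0 A1 A"
    unfolding A1_def using L d submod_sub by (intro dsum_restrict[OF L(1)]) (auto simp: T_def)
  note a = dsumD[OF A01]
  define K' where "K' = A1 \<boxplus> K"
  have AK': "dsum A1 K K'" "dsum A0 K' (carrier M)" unfolding K'_def using dsum_assoc[OF A01 AK] by auto
  note k = dsumD[OF AK'(1)] and k' = dsumD[OF AK'(2)]
  have IK': "sm (I \<boxplus> K')" using sI k sm_sum by blast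
  have "S \<subseteq> K'" using S(2) k(7) by blast
  then have "I \<boxplus> S \<subseteq> I \<boxplus> K'" by (intro sum_mono order.refl)
  then have "A0 \<subseteq> I \<boxplus> K'" using L(2) unfolding T_def by blast
  then have "A0 \<boxplus> K' \<subseteq> I \<boxplus> K'" using sum_upper2[OF sI k(3)] IK' by (intro sum_least)
  then have full: "I \<boxplus> K' = carrier M" using k'(4) submod_sub[OF IK'] by blast
  have AK1: "A \<inter> K' = A1"
  proof -
    have "K' \<inter> A = A1 \<boxplus> (K \<inter> A)" unfolding K'_def using a d by (intro modular_law) auto
    also have "\<dots> = A1" using sum_zero[OF a(2)] d(5) by (simp add: Int_commute)
    finally show ?thesis by blast
  qed
  have "I \<inter> K' \<subseteq> S \<boxplus> (T \<inter> L)"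
  proof
    fix x assume x: "x \<in> I \<inter> K'"
    then have "x \<in> (S \<boxplus> A) \<inter> K'" using S(3) sum_comm[OF d(1) sS] by auto
    also have "\<dots> = S \<boxplus> (A \<inter> K')" using sS d k \<open>S \<subseteq> K'\<close> by (intro modular_law)
    finally obtain s y where sy: "s \<in> S" "y \<in> A1" "x = s \<oplus>\<^bsub>M\<^esub> y" unfolding AK1 by (auto elim: mem_sumE)
    have c: "s \<in> carrier M" "y \<in> carrier M" using sy submod_carrier sS a by auto
    have "y = x \<oplus>\<^bsub>M\<^esub> (\<ominus>\<^bsub>M\<^esub> s)" using c sy M.r_neg1[of s y] M.a_comm[of s y] by (simp add: M.a_assoc M.r_neg)
    moreover have "x \<oplus>\<^bsub>M\<^esub> (\<ominus>\<^bsub>M\<^esub> s) \<in> I \<boxplus> S" using mem_sumI x submod_neg[OF sS sy(1)] by blast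
    ultimately have "y \<in> I \<boxplus> S" by simp
    then have "y \<in> T \<inter> L" using sy(2) unfolding T_def A1_def by blast
    then show "x \<in> S \<boxplus> (T \<inter> L)" using sy mem_sumI by blast
  qed
  moreover have "small (S \<boxplus> (T \<inter> L))" using S(1) L(3) small_sum by blast
  ultimately have 1: "dsum I K' (carrier M)"
    using I summandI2[OF AK'(2)] full by (intro dsum_if_small_Int)
  have IA1: "sm (I \<boxplus> A1)" using sI a sm_sum by blast
  have "I \<lesssim> A" using S le_smallI by blast
  then have le: "I \<boxplus> A1 \<lesssim> A" using le_small_sum subset_le_small a by blast
  have "A0 \<lesssim> I \<boxplus> A1"
    using L(2) sum_mono[OF sum_upper1[OF sI a(2)] order.refl] by (intro le_smallI[OF S(1)]) (auto simp: T_def)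
  moreover have "A1 \<lesssim> I \<boxplus> A1" using subset_le_small IA1 sum_upper2 sI a by blast
  ultimately have "A \<lesssim> I \<boxplus> A1" using le_small_sum IA1 a(4) by blast
  then have 2: "I \<boxplus> A1 \<approx> A" using le unfolding eq_small_def by blast
  show thesis using that[of A1] a AK'(1) 1 2 unfolding K'_def by blast
qed

text \<open>\<open>I\<close> stands in for \<open>A \<inter> B\<close>, which need not be a summand.
  It lies in \<open>A\<close> only up to a small submodule, and for this reason \<open>A\<close> is
  recovered only up to \<open>\<approx>\<close>, whereas \<open>B\<close> is recovered
  exactly.\<close>

lemma good_position:
  assumes "summand A" "summand B"
  obtains I A1 Y Q where "dsums [I, A1, Y, Q] (carrier M)" "I \<boxplus> A1 \<approx> A" "dsum I Y B"
proof -
  obtain Ac where Ac: "dsum A Ac (carrier M)" using assms summandE by blast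
  note d = dsumD[OF Ac] and sB = summand_sm[OF assms(2)]
  have AB: "sm (A \<boxplus> B)" using d sB sm_sum by blast
  \<comment> \<open>The projection of \<open>B\<close> to \<open>Ac\<close> along \<open>A\<close>.
    \<open>D1\<close> splits it into a summand \<open>P\<close> of \<open>M\<close> and a small
    submodule, called \<open>S\<close> below.\<close>
  define X where "X = (A \<boxplus> B) \<inter> Ac"
  have sX: "sm X" unfolding X_def using AB d sm_Int by blast
  obtain P P' where P: "dsum P P' (carrier M)" "P \<subseteq> X" "small (X \<inter> P')" using D1[OF sX] .
  note p = dsumD[OF P(1)]
  define Q where "Q = Ac \<inter> P'"
  define S where "S = X \<inter> P'"
  have PQ: "dsum P Q Ac"
    unfolding Q_def using P d submod_sub by (intro dsum_restrict[OF P(1)]) (auto simp: X_def)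
  note q = dsumD[OF PQ]
  have sS: "sm S" unfolding S_def using sX p sm_Int by blast
  have SQ: "S \<subseteq> Q" unfolding S_def Q_def X_def by blast
  have XPS: "X = P \<boxplus> S"
    unfolding S_def using dsumD(4)[OF dsum_restrict[OF P(1) sX P(2) submod_sub[OF sX]]] by simp
  \<comment> \<open>\<open>E\<close> is a complement of \<open>P\<close>. As \<open>P\<close> lies
    in \<open>A \<boxplus> B\<close>, the submodules \<open>B\<close> and \<open>E\<close> fill
    \<open>M\<close>, and \<open>D3\<close> makes \<open>B \<inter> E\<close> a summand.\<close>
  define E where "E = A \<boxplus> Q"
  have AE: "dsum A Q E" "dsum P E (carrier M)"
    using dsum_assoc'[OF Ac dsum_comm[OF PQ]] dsum_comm unfolding E_def by auto
  note e = dsumD[OF AE(1)] and e' = dsumD[OF AE(2)]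
  have BE: "sm (B \<boxplus> E)" using sB e sm_sum by blast
  have "A \<boxplus> B \<subseteq> B \<boxplus> E"
    using sum_upper1[OF sB e(3)] sum_upper2[OF sB e(3)] e(6) by (intro sum_least[OF BE]) auto
  then have "P \<subseteq> B \<boxplus> E" using P(2) unfolding X_def by blast
  then have "P \<boxplus> E \<subseteq> B \<boxplus> E" using BE sum_upper2[OF sB e(3)] by (intro sum_least)
  then have full: "B \<boxplus> E = carrier M" using e'(4) submod_sub[OF BE] by blast
  define I where "I = B \<inter> E"
  have I: "summand I" unfolding I_def using D3 assms(2) summandI2[OF AE(2)] full by blast
  then obtain L where L: "dsum I L (carrier M)" using summandE by blast
  define Y where "Y = B \<inter> L"
  have IY: "dsum I Y B" unfolding Y_def using sB submod_sub by (intro dsum_restrict[OF L]) (auto simp: I_def)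
  note i = dsumD[OF IY]
  \<comment> \<open>\<open>Y\<close> takes the place of \<open>P\<close> as a complement of
    \<open>E\<close>: it completes \<open>B \<inter> E\<close> to \<open>B\<close>, and
    \<open>B\<close> and \<open>E\<close> fill \<open>M\<close>.\<close>
  have EY: "dsum E Y (carrier M)"
  proof (rule dsumI)
    have EYs: "sm (E \<boxplus> Y)" by (rule sm_sum[OF e(3) i(2)])
    have "I \<subseteq> E" "E \<subseteq> E \<boxplus> Y" "Y \<subseteq> E \<boxplus> Y"
      using sum_upper1[OF e(3) i(2)] sum_upper2[OF e(3) i(2)] unfolding I_def by auto
    then have "I \<boxplus> Y \<subseteq> E \<boxplus> Y" by (intro sum_least[OF EYs]) auto
    then have "B \<boxplus> E \<subseteq> E \<boxplus> Y" using \<open>E \<subseteq> E \<boxplus> Y\<close> i(4) by (intro sum_least[OF EYs]) auto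
    then show "E \<boxplus> Y = carrier M" using full submod_sub[OF EYs] by blast
    show "E \<inter> Y \<subseteq> {\<zero>\<^bsub>M\<^esub>}" using i(5,7) unfolding I_def by blast
  qed (use e i in auto)
  define K where "K = Q \<boxplus> Y"
  have AK: "dsum Q Y K" "dsum A K (carrier M)" unfolding K_def using dsum_assoc[OF AE(1) EY] by auto
  \<comment> \<open>Intersecting \<open>A \<boxplus> S \<boxplus> P\<close> with \<open>E\<close>
    removes \<open>P\<close>, so \<open>I\<close> lies in \<open>A \<boxplus> S\<close>. Since
    \<open>S\<close> is contained in \<open>Q\<close>, hence in \<open>K\<close>,
    \<open>summand_replace\<close> applies.\<close>
  have "A \<boxplus> B = A \<boxplus> X"
    using dsumD(4)[OF dsum_restrict[OF Ac AB sum_upper1[OF d(1) sB] submod_sub[OF AB]]]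
    unfolding X_def by simp
  also have "\<dots> = (A \<boxplus> S) \<boxplus> P"
    unfolding XPS using sum_assoc sum_comm p(1) sS d(1) by metis
  finally have ABS: "A \<boxplus> B = (A \<boxplus> S) \<boxplus> P" .
  have "A \<boxplus> S \<subseteq> E" unfolding E_def using SQ by (intro sum_mono) auto
  then have "(A \<boxplus> B) \<inter> E = (A \<boxplus> S) \<boxplus> (P \<inter> E)"
    unfolding ABS using d sS p e sm_sum by (intro modular_law) auto
  then have "(A \<boxplus> B) \<inter> E = A \<boxplus> S" using e'(5) sum_zero sm_sum[OF d(1) sS] by auto
  moreover have "I \<subseteq> (A \<boxplus> B) \<inter> E" unfolding I_def using sum_upper2[OF d(1) sB] by blast
  ultimately have IAS: "I \<subseteq> A \<boxplus> S" by simp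
  have "S \<subseteq> K" using SQ dsumD(6)[OF AK(1)] by blast
  then obtain A1 where A1: "dsum A1 K (A1 \<boxplus> K)" "dsum I (A1 \<boxplus> K) (carrier M)" "I \<boxplus> A1 \<approx> A"
    using summand_replace[OF AK(2) I _ _ IAS] P(3) unfolding S_def by metis
  have "dsums [I, A1, Y, Q] (carrier M)"
    using A1 dsum_comm[OF AK(1)] unfolding dsums.simps(2)[of I] dsums.simps(2)[of A1] dsums_2 by blast
  then show thesis using that A1 IY by blast
qed

text \<open>\<open>D1\<close> gives a summand \<open>F\<close> inside the union, with complement
  \<open>K\<close> such that \<open>?U \<inter> K\<close> is small. Each \<open>X n\<close> lies in
  \<open>F\<close> up to this small submodule, so by \<open>summand_replace\<close> it has a
  complement containing \<open>K\<close>. Hence no member of the chain meets \<open>K\<close>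
  nontrivially, and the union equals \<open>F\<close>.\<close>

lemma summand_Union_chain:
  assumes "\<And>n. summand (X n)" "\<And>n. X n \<subseteq> X (Suc n)"
  shows "summand (\<Union>n::nat. X n)"
proof -
  let ?U = "\<Union>n. X n"
  have s: "sm (X n)" for n using assms(1) summand_sm by blast
  have mono: "X m \<subseteq> X n" if "m \<le> n" for m n using lift_Suc_mono_le[of X, OF assms(2) that] .
  have U: "sm ?U"
  proof (rule submodI_smult)
    show "?U \<subseteq> carrier M" using s submod_sub by blast
    show "\<zero>\<^bsub>M\<^esub> \<in> ?U" using s submod_zero by blast
    show "a \<odot>\<^bsub>M\<^esub> x \<in> ?U" if "a \<in> carrier R" "x \<in> ?U" for a x using that s submod_smult by blast
    fix x y assume "x \<in> ?U" "y \<in> ?U"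
    then obtain m n where "x \<in> X m" "y \<in> X n" by blast
    then have "x \<in> X (max m n)" "y \<in> X (max m n)" using mono[of m "max m n"] mono[of n "max m n"] by auto
    then show "x \<oplus>\<^bsub>M\<^esub> y \<in> ?U" using s submod_add by blast
  qed
  obtain F K where FK: "dsum F K (carrier M)" "F \<subseteq> ?U" "small (?U \<inter> K)" using D1[OF U] .
  have FU: "dsum F (?U \<inter> K) ?U" using FK U submod_sub by (intro dsum_restrict[OF FK(1)]) auto
  have "X n \<inter> K \<subseteq> {\<zero>\<^bsub>M\<^esub>}" for n
  proof -
    have "X n \<subseteq> F \<boxplus> (?U \<inter> K)" using dsumD(4)[OF FU] by auto
    then obtain A1 where "dsum (X n) (A1 \<boxplus> K) (carrier M)" "dsum A1 K (A1 \<boxplus> K)"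
      using summand_replace[OF FK(1) assms(1) FK(3)] by blast
    then show ?thesis using dsumD(5,7) by blast
  qed
  then have "?U \<inter> K \<subseteq> {\<zero>\<^bsub>M\<^esub>}" by blast
  then have "?U \<inter> K = {\<zero>\<^bsub>M\<^esub>}" using dsumD(5)[OF FU] by blast
  then have "?U = F" using dsumD(4)[OF FU] sum_zero dsumD(1)[OF FU] by simp
  then show ?thesis using FK summandI by metis
qed

end

section \<open>Isomorphisms between submodules\<close>

context left_module
begin

lemma sub_isoD:
  assumes "h \<in> sub_iso X Y"
  shows "bij_betw h X Y" "inj_on h X" "h ` X = Y"
    "x \<in> X \<Longrightarrow> h x \<in> Y"
    "x \<in> X \<Longrightarrow> y \<in> X \<Longrightarrow> h (x \<oplus>\<^bsub>M\<^esub> y) = h x \<oplus>\<^bsub>M\<^esub> h y"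
    "a \<in> carrier R \<Longrightarrow> x \<in> X \<Longrightarrow> h (a \<odot>\<^bsub>M\<^esub> x) = a \<odot>\<^bsub>M\<^esub> h x"
  using assms unfolding module_iso_def by (auto simp: bij_betw_def)

lemma sub_isoI:
  assumes "bij_betw h X Y"
    "\<And>x y. x \<in> X \<Longrightarrow> y \<in> X \<Longrightarrow> h (x \<oplus>\<^bsub>M\<^esub> y) = h x \<oplus>\<^bsub>M\<^esub> h y"
    "\<And>a x. a \<in> carrier R \<Longrightarrow> x \<in> X \<Longrightarrow> h (a \<odot>\<^bsub>M\<^esub> x) = a \<odot>\<^bsub>M\<^esub> h x"
  shows "h \<in> sub_iso X Y"
  using assms unfolding module_iso_def by auto

lemma sub_iso_zero:
  assumes "h \<in> sub_iso X Y" "sm X" "sm Y"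
  shows "h \<zero>\<^bsub>M\<^esub> = \<zero>\<^bsub>M\<^esub>"
proof -
  note z = submod_zero[OF assms(2)]
  have "h \<zero>\<^bsub>M\<^esub> \<oplus>\<^bsub>M\<^esub> h \<zero>\<^bsub>M\<^esub> = h \<zero>\<^bsub>M\<^esub>" using sub_isoD(5)[OF assms(1) z z] by simp
  moreover have "h \<zero>\<^bsub>M\<^esub> \<in> carrier M" using sub_isoD(4)[OF assms(1) z] assms(3) submod_carrier by blast
  ultimately show ?thesis by simp
qed

lemma isomorphicE:
  assumes "X \<cong>\<^sub>M Y" obtains h where "h \<in> sub_iso X Y"
  using assms unfolding isomorphic_def by blast

lemma isomorphicI: "h \<in> sub_iso X Y \<Longrightarrow> X \<cong>\<^sub>M Y"
  unfolding isomorphic_def by blast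

lemma isomorphic_refl: "X \<cong>\<^sub>M X"
  by (rule isomorphicI[of id], rule sub_isoI) auto

lemma isomorphic_sym:
  assumes "X \<cong>\<^sub>M Y" "sm X" shows "Y \<cong>\<^sub>M X"
proof -
  obtain h where h: "h \<in> sub_iso X Y" using assms(1) isomorphicE by blast
  note d = sub_isoD[OF h]
  define g where "g = inv_into X h"
  have g: "g y \<in> X" "h (g y) = y" if "y \<in> Y" for y
    unfolding g_def using that d(3) by (auto intro: inv_into_into f_inv_into_f)
  have gh: "g (h x) = x" if "x \<in> X" for x unfolding g_def using that d(2) by simp
  have "g \<in> sub_iso Y X"
  proof (rule sub_isoI)
    show "bij_betw g Y X" unfolding g_def using d(1) by (rule bij_betw_inv_into)
    show "g (x \<oplus>\<^bsub>M\<^esub> y) = g x \<oplus>\<^bsub>M\<^esub> g y" if "x \<in> Y" "y \<in> Y" for x y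
      using gh[of "g x \<oplus>\<^bsub>M\<^esub> g y"] d(5)[of "g x" "g y"] g that submod_add[OF assms(2)] by simp
    show "g (a \<odot>\<^bsub>M\<^esub> y) = a \<odot>\<^bsub>M\<^esub> g y" if "a \<in> carrier R" "y \<in> Y" for a y
      using gh[of "a \<odot>\<^bsub>M\<^esub> g y"] d(6)[of a "g y"] g that submod_smult[OF assms(2)] by simp
  qed
  then show ?thesis by (rule isomorphicI)
qed

lemma sub_iso_comp:
  assumes "h \<in> sub_iso X Y" "k \<in> sub_iso Y Z"
  shows "k \<circ> h \<in> sub_iso X Z"
  using sub_isoD[OF assms(1)] sub_isoD[OF assms(2)]
  by (intro sub_isoI) (auto intro: bij_betw_trans)

lemma isomorphic_trans: "X \<cong>\<^sub>M Y \<Longrightarrow> Y \<cong>\<^sub>M Z \<Longrightarrow> X \<cong>\<^sub>M Z"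
  using sub_iso_comp isomorphicE isomorphicI by metis

lemma sub_iso_restrict:
  assumes "h \<in> sub_iso X Y" "A \<subseteq> X" shows "h \<in> sub_iso A (h ` A)"
  using sub_isoD[OF assms(1)] assms(2)
  by (intro sub_isoI) (auto simp: bij_betw_def inj_on_subset subset_iff)

lemma sub_iso_submodule:
  assumes "h \<in> sub_iso X Y" "sm X" "sm Y" "sm A" "A \<subseteq> X" shows "sm (h ` A)"
proof (rule submodI_smult)
  note d = sub_isoD[OF assms(1)]
  show "h ` A \<subseteq> carrier M" using d(4) assms(3,5) submod_carrier by blast
  show "\<zero>\<^bsub>M\<^esub> \<in> h ` A" using sub_iso_zero[OF assms(1-3)] submod_zero[OF assms(4)] by force
  fix u assume u: "u \<in> h ` A"
  then obtain x where x: "x \<in> A" "u = h x" by blast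
  show "a \<odot>\<^bsub>M\<^esub> u \<in> h ` A" if "a \<in> carrier R" for a
    using d(6)[of a x, symmetric] x that assms(5) submod_smult[OF assms(4)] by blast
  fix v assume "v \<in> h ` A"
  then obtain y where y: "y \<in> A" "v = h y" by blast
  then show "u \<oplus>\<^bsub>M\<^esub> v \<in> h ` A"
    using d(5)[of x y, symmetric] x y assms(5) submod_add[OF assms(4)] by blast
qed

lemma sub_iso_image_sum:
  assumes "h \<in> sub_iso X Y" "A \<subseteq> X" "B \<subseteq> X" shows "h ` (A \<boxplus> B) = h ` A \<boxplus> h ` B"
proof (intro subset_antisym subsetI)
  have *: "h (x \<oplus>\<^bsub>M\<^esub> y) = h x \<oplus>\<^bsub>M\<^esub> h y" if "x \<in> A" "y \<in> B" for x y
    using sub_isoD(5)[OF assms(1)] that assms by blast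
  show "u \<in> h ` A \<boxplus> h ` B" if "u \<in> h ` (A \<boxplus> B)" for u
    using that * by (auto elim!: mem_sumE intro!: mem_sumI)
  show "u \<in> h ` (A \<boxplus> B)" if "u \<in> h ` A \<boxplus> h ` B" for u
    using that * by (auto elim!: mem_sumE intro!: mem_sumI image_eqI)
qed

lemma sub_iso_dsum:
  assumes h: "h \<in> sub_iso X Y" "sm X" "sm Y" and d: "dsum A B C" "C \<subseteq> X"
  shows "dsum (h ` A) (h ` B) (h ` C)"
proof (rule dsumI)
  have s: "A \<subseteq> X" "B \<subseteq> X" using dsumD(6,7)[OF d(1)] d(2) by auto
  show "sm (h ` A)" "sm (h ` B)" using sub_iso_submodule h dsumD(1,2)[OF d(1)] s by auto
  show "h ` A \<boxplus> h ` B = h ` C" using sub_iso_image_sum[OF h(1) s] dsumD(4)[OF d(1)] by simp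
  have "h ` A \<inter> h ` B = h ` (A \<inter> B)" using inj_on_image_Int[OF sub_isoD(2)[OF h(1)] s] by simp
  then show "h ` A \<inter> h ` B \<subseteq> {\<zero>\<^bsub>M\<^esub>}" using dsumD(5)[OF d(1)] sub_iso_zero[OF h] by simp
qed

lemma isomorphicI_kernel:
  assumes "sm X" "sm Y" "h ` X = Y"
    and add: "\<And>x y. x \<in> X \<Longrightarrow> y \<in> X \<Longrightarrow> h (x \<oplus>\<^bsub>M\<^esub> y) = h x \<oplus>\<^bsub>M\<^esub> h y"
    and smult: "\<And>a x. a \<in> carrier R \<Longrightarrow> x \<in> X \<Longrightarrow> h (a \<odot>\<^bsub>M\<^esub> x) = a \<odot>\<^bsub>M\<^esub> h x"
    and ker: "\<And>x. x \<in> X \<Longrightarrow> h x = \<zero>\<^bsub>M\<^esub> \<Longrightarrow> x = \<zero>\<^bsub>M\<^esub>"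
  shows "X \<cong>\<^sub>M Y"
proof (rule isomorphicI, rule sub_isoI)
  have c: "x \<in> carrier M" "h x \<in> carrier M" if "x \<in> X" for x
    using that assms(1-3) submod_carrier by auto
  have "inj_on h X"
  proof (rule inj_onI)
    fix x y assume xy: "x \<in> X" "y \<in> X" "h x = h y"
    have d: "x \<ominus>\<^bsub>M\<^esub> y \<in> X" using submod_diff[OF assms(1)] xy by blast
    have "h y \<oplus>\<^bsub>M\<^esub> h (x \<ominus>\<^bsub>M\<^esub> y) = h y"
      using add[OF xy(2) d] add_diff_cancel[of x y] c xy by simp
    then have "h (x \<ominus>\<^bsub>M\<^esub> y) = \<zero>\<^bsub>M\<^esub>" using c(2)[OF d] c(2)[OF xy(2)] by simp
    then show "x = y" using ker[OF d] eq_if_diff_zero c xy by blast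
  qed
  then show "bij_betw h X Y" using assms(3) by (simp add: bij_betw_def)
qed (use add smult in auto)

text \<open>A total function whose value is determined only for \<open>z\<close> in a direct sum of
  \<open>X\<close> and \<open>Y\<close>.\<close>

definition proj :: "'b set \<Rightarrow> 'b set \<Rightarrow> 'b \<Rightarrow> 'b"
  where "proj X Y z = (THE x. x \<in> X \<and> (\<exists>y\<in>Y. z = x \<oplus>\<^bsub>M\<^esub> y))"

lemma proj_eq:
  assumes "dsum X Y Z" "x \<in> X" "y \<in> Y"
  shows "proj X Y (x \<oplus>\<^bsub>M\<^esub> y) = x"
  unfolding proj_def
proof (rule the_equality)
  note d = dsumD[OF assms(1)]
  show "x \<in> X \<and> (\<exists>y'\<in>Y. x \<oplus>\<^bsub>M\<^esub> y = x \<oplus>\<^bsub>M\<^esub> y')" using assms by blast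
  fix u assume "u \<in> X \<and> (\<exists>y'\<in>Y. x \<oplus>\<^bsub>M\<^esub> y = u \<oplus>\<^bsub>M\<^esub> y')"
  then obtain v where uv: "u \<in> X" "v \<in> Y" "x \<oplus>\<^bsub>M\<^esub> y = u \<oplus>\<^bsub>M\<^esub> v" by blast
  have c: "x \<in> carrier M" "y \<in> carrier M" "u \<in> carrier M" "v \<in> carrier M"
    using assms uv d submod_carrier by auto
  have "u \<oplus>\<^bsub>M\<^esub> (v \<ominus>\<^bsub>M\<^esub> y) = (u \<oplus>\<^bsub>M\<^esub> v) \<ominus>\<^bsub>M\<^esub> y"
    using c by (simp add: a_minus_def M.a_assoc)
  also have "\<dots> = x" using c unfolding uv(3)[symmetric] by (simp add: a_minus_def M.a_assoc M.r_neg)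
  finally have e: "u \<oplus>\<^bsub>M\<^esub> (v \<ominus>\<^bsub>M\<^esub> y) = x" .
  have "v \<ominus>\<^bsub>M\<^esub> y = \<ominus>\<^bsub>M\<^esub> u \<oplus>\<^bsub>M\<^esub> x" using c M.r_neg1[of u "v \<ominus>\<^bsub>M\<^esub> y"] e by simp
  then have "v \<ominus>\<^bsub>M\<^esub> y \<in> X" using submod_add[OF d(1) submod_neg[OF d(1) uv(1)] assms(2)] by simp
  moreover have "v \<ominus>\<^bsub>M\<^esub> y \<in> Y" using submod_diff[OF d(2) uv(2) assms(3)] .
  ultimately have "v \<ominus>\<^bsub>M\<^esub> y = \<zero>\<^bsub>M\<^esub>" using d(5) by blast
  then show "u = x" using e c by simp
qed

lemma proj_eq':
  assumes "dsum X Y Z" "x \<in> X" "y \<in> Y"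
  shows "proj Y X (x \<oplus>\<^bsub>M\<^esub> y) = y"
  using proj_eq[OF dsum_comm[OF assms(1)] assms(3,2)] M.a_comm[of x y] assms dsumD[OF assms(1)]
    submod_carrier by metis

lemma dsum_cases:
  assumes "dsum X Y Z" "z \<in> Z"
  obtains x y where "x \<in> X" "y \<in> Y" "x \<in> carrier M" "y \<in> carrier M" "z = x \<oplus>\<^bsub>M\<^esub> y"
    "proj X Y z = x" "proj Y X z = y"
proof -
  note d = dsumD[OF assms(1)]
  obtain x y where xy: "x \<in> X" "y \<in> Y" "z = x \<oplus>\<^bsub>M\<^esub> y" using assms(2) d(4) mem_sumE by metis
  show thesis
    by (rule that[OF xy(1,2) submod_carrier[OF d(1) xy(1)] submod_carrier[OF d(2) xy(2)] xy(3)])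
      (simp_all add: xy(3) proj_eq[OF assms(1) xy(1,2)] proj_eq'[OF assms(1) xy(1,2)])
qed

lemma proj_hom:
  assumes "dsum X Y Z"
  shows "z \<in> Z \<Longrightarrow> proj X Y z \<in> X"
    "z \<in> Z \<Longrightarrow> w \<in> Z \<Longrightarrow> proj X Y (z \<oplus>\<^bsub>M\<^esub> w) = proj X Y z \<oplus>\<^bsub>M\<^esub> proj X Y w"
    "a \<in> carrier R \<Longrightarrow> z \<in> Z \<Longrightarrow> proj X Y (a \<odot>\<^bsub>M\<^esub> z) = a \<odot>\<^bsub>M\<^esub> proj X Y z"
proof -
  note d = dsumD[OF assms]
  show "proj X Y z \<in> X" if "z \<in> Z" using dsum_cases[OF assms that] by metis
  show "proj X Y (z \<oplus>\<^bsub>M\<^esub> w) = proj X Y z \<oplus>\<^bsub>M\<^esub> proj X Y w" if zw: "z \<in> Z" "w \<in> Z"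
  proof -
    obtain x y where x: "x \<in> X" "y \<in> Y" "x \<in> carrier M" "y \<in> carrier M" "z = x \<oplus>\<^bsub>M\<^esub> y"
      "proj X Y z = x" by (rule dsum_cases[OF assms zw(1)])
    obtain u v where u: "u \<in> X" "v \<in> Y" "u \<in> carrier M" "v \<in> carrier M" "w = u \<oplus>\<^bsub>M\<^esub> v"
      "proj X Y w = u" by (rule dsum_cases[OF assms zw(2)])
    have "z \<oplus>\<^bsub>M\<^esub> w = (x \<oplus>\<^bsub>M\<^esub> u) \<oplus>\<^bsub>M\<^esub> (y \<oplus>\<^bsub>M\<^esub> v)" using x u by (simp add: M.a_ac)
    then show ?thesis
      using proj_eq[OF assms submod_add[OF d(1) x(1) u(1)] submod_add[OF d(2) x(2) u(2)]] x u by simp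
  qed
  show "proj X Y (a \<odot>\<^bsub>M\<^esub> z) = a \<odot>\<^bsub>M\<^esub> proj X Y z" if az: "a \<in> carrier R" "z \<in> Z"
  proof -
    obtain x y where x: "x \<in> X" "y \<in> Y" "x \<in> carrier M" "y \<in> carrier M" "z = x \<oplus>\<^bsub>M\<^esub> y"
      "proj X Y z = x" by (rule dsum_cases[OF assms az(2)])
    then have "a \<odot>\<^bsub>M\<^esub> z = a \<odot>\<^bsub>M\<^esub> x \<oplus>\<^bsub>M\<^esub> a \<odot>\<^bsub>M\<^esub> y" using smult_r_distr az by simp
    then show ?thesis
      using proj_eq[OF assms submod_smult[OF d(1) az(1) x(1)] submod_smult[OF d(2) az(1) x(2)]] x by simp
  qed
qed

text \<open>Both submodules are copies of the quotient of \<open>Z\<close> by \<open>K\<close>. The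
  isomorphism is the projection to \<open>B\<close> along \<open>K\<close>, restricted to
  \<open>A\<close>.\<close>

lemma isomorphic_if_common_complement:
  assumes "dsum A K Z" "dsum B K Z"
  shows "A \<cong>\<^sub>M B"
proof (rule isomorphicI_kernel[where h = "proj B K"])
  note a = dsumD[OF assms(1)] and b = dsumD[OF assms(2)]
  have AZ: "x \<in> Z" if "x \<in> A" for x using a(6) that by blast
  show "sm A" "sm B" using a b by auto
  show "proj B K ` A = B"
  proof (intro subset_antisym subsetI)
    show "y \<in> B" if "y \<in> proj B K ` A" for y using that proj_hom(1)[OF assms(2)] AZ by blast
    fix y assume y: "y \<in> B"
    then obtain x k where x: "x \<in> A" "k \<in> K" "x \<in> carrier M" "k \<in> carrier M" "y = x \<oplus>\<^bsub>M\<^esub> k"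
      using dsum_cases[OF assms(1)] b(6) by blast
    have "x = y \<oplus>\<^bsub>M\<^esub> (\<ominus>\<^bsub>M\<^esub> k)" using x by (simp add: M.a_assoc M.r_neg)
    then have "proj B K x = y" using proj_eq[OF assms(2) y submod_neg[OF a(2) x(2)]] by simp
    then show "y \<in> proj B K ` A" using x by blast
  qed
  show "x = \<zero>\<^bsub>M\<^esub>" if x: "x \<in> A" "proj B K x = \<zero>\<^bsub>M\<^esub>" for x
  proof -
    obtain y k where "y \<in> B" "k \<in> K" "k \<in> carrier M" "x = y \<oplus>\<^bsub>M\<^esub> k" "proj B K x = y"
      using dsum_cases[OF assms(2) AZ[OF x(1)]] by metis
    then have "x \<in> K" using x(2) by simp
    then show ?thesis using x a(5) by blast
  qed
qed (use proj_hom(2,3)[OF assms(2)] subsetD[OF dsumD(6)[OF assms(1)]] in blast)+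

lemma isomorphic_dsum:
  assumes X: "dsum X1 X2 X" and Y: "dsum Y1 Y2 Y" and "X1 \<cong>\<^sub>M Y1" "X2 \<cong>\<^sub>M Y2"
  shows "X \<cong>\<^sub>M Y"
proof -
  obtain f where f: "f \<in> sub_iso X1 Y1" using assms isomorphicE by blast
  obtain g where g: "g \<in> sub_iso X2 Y2" using assms isomorphicE by blast
  note x = dsumD[OF X] and y = dsumD[OF Y] and fD = sub_isoD[OF f] and gD = sub_isoD[OF g]
  define h where "h z = f (proj X1 X2 z) \<oplus>\<^bsub>M\<^esub> g (proj X2 X1 z)" for z
  note p = proj_hom[OF X] and q = proj_hom[OF dsum_comm[OF X]]
  have fc: "f u \<in> carrier M" if "u \<in> X1" for u using that fD(4) y(1) submod_carrier by blast
  have gc: "g u \<in> carrier M" if "u \<in> X2" for u using that gD(4) y(2) submod_carrier by blast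
  have h_eq: "h (u \<oplus>\<^bsub>M\<^esub> v) = f u \<oplus>\<^bsub>M\<^esub> g v" if "u \<in> X1" "v \<in> X2" for u v
    unfolding h_def using proj_eq[OF X that] proj_eq'[OF X that] by simp
  show ?thesis
  proof (rule isomorphicI_kernel[where h = h])
    show "sm X" "sm Y" using x y by auto
    have "h ` X = (\<lambda>(u, v). f u \<oplus>\<^bsub>M\<^esub> g v) ` (X1 \<times> X2)"
    proof (intro subset_antisym subsetI)
      fix w assume "w \<in> h ` X"
      then obtain u v where "u \<in> X1" "v \<in> X2" "w = h (u \<oplus>\<^bsub>M\<^esub> v)"
        unfolding x(4)[symmetric] by (auto elim!: mem_sumE)
      then show "w \<in> (\<lambda>(u, v). f u \<oplus>\<^bsub>M\<^esub> g v) ` (X1 \<times> X2)" using h_eq by auto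
    next
      fix w assume "w \<in> (\<lambda>(u, v). f u \<oplus>\<^bsub>M\<^esub> g v) ` (X1 \<times> X2)"
      then obtain u v where uv: "u \<in> X1" "v \<in> X2" "w = f u \<oplus>\<^bsub>M\<^esub> g v" by auto
      then have "w = h (u \<oplus>\<^bsub>M\<^esub> v)" "u \<oplus>\<^bsub>M\<^esub> v \<in> X" using h_eq mem_sumI x(4) by auto
      then show "w \<in> h ` X" by blast
    qed
    also have "\<dots> = Y1 \<boxplus> Y2"
      unfolding fD(3)[symmetric] gD(3)[symmetric] by (auto elim!: mem_sumE intro: mem_sumI)
    finally show "h ` X = Y" using y(4) by simp
    show "h (z \<oplus>\<^bsub>M\<^esub> w) = h z \<oplus>\<^bsub>M\<^esub> h w" if "z \<in> X" "w \<in> X" for z w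
      unfolding h_def using that p q fD(5) gD(5) fc gc by (simp add: M.a_ac)
    show "h (a \<odot>\<^bsub>M\<^esub> z) = a \<odot>\<^bsub>M\<^esub> h z" if "a \<in> carrier R" "z \<in> X" for a z
      unfolding h_def using that p q fD(6) gD(6) fc gc smult_r_distr by simp
    fix z assume z: "z \<in> X" "h z = \<zero>\<^bsub>M\<^esub>"
    obtain u v where uv: "u \<in> X1" "v \<in> X2" "u \<in> carrier M" "v \<in> carrier M" "z = u \<oplus>\<^bsub>M\<^esub> v"
      by (rule dsum_cases[OF X z(1)])
    have 0: "f u \<oplus>\<^bsub>M\<^esub> g v = \<zero>\<^bsub>M\<^esub>" using h_eq[OF uv(1,2)] z(2) uv(5) by simp
    \<comment> \<open>The components of zero in \<open>Y1\<close> and \<open>Y2\<close> are unique,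
      so \<open>f u\<close> and \<open>g v\<close> both vanish.\<close>
    have "f u = proj Y1 Y2 (f u \<oplus>\<^bsub>M\<^esub> g v)" "g v = proj Y2 Y1 (f u \<oplus>\<^bsub>M\<^esub> g v)"
      using proj_eq[OF Y] proj_eq'[OF Y] fD(4) gD(4) uv by auto
    moreover have "proj Y1 Y2 (\<zero>\<^bsub>M\<^esub> \<oplus>\<^bsub>M\<^esub> \<zero>\<^bsub>M\<^esub>) = \<zero>\<^bsub>M\<^esub>" "proj Y2 Y1 (\<zero>\<^bsub>M\<^esub> \<oplus>\<^bsub>M\<^esub> \<zero>\<^bsub>M\<^esub>) = \<zero>\<^bsub>M\<^esub>"
      using proj_eq[OF Y] proj_eq'[OF Y] submod_zero y(1,2) by blast+
    ultimately have "f u = f \<zero>\<^bsub>M\<^esub>" "g v = g \<zero>\<^bsub>M\<^esub>"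
      using 0 sub_iso_zero[OF f x(1) y(1)] sub_iso_zero[OF g x(2) y(2)] by auto
    then have "u = \<zero>\<^bsub>M\<^esub>" "v = \<zero>\<^bsub>M\<^esub>"
      using fD(2) gD(2) uv submod_zero x(1,2) by (auto dest: inj_onD)
    then show "z = \<zero>\<^bsub>M\<^esub>" using uv by simp
  qed
qed

text \<open>\<open>G\<close> is the graph of an isomorphism \<open>h\<close>. It is a complement of
  \<open>Y\<close> because \<open>h\<close> is a homomorphism into \<open>Y\<close>; injectivity of
  \<open>h\<close> makes it miss \<open>X\<close>, and surjectivity puts \<open>Y\<close> inside
  \<open>X \<boxplus> G\<close>.\<close>

lemma graph_complement:
  assumes "dsum X Y Z" "X \<cong>\<^sub>M Y"
  obtains G where "dsum X G Z" "dsum Y G Z"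
proof -
  note d = dsumD[OF assms(1)]
  obtain h where h: "h \<in> sub_iso X Y" using assms isomorphicE by blast
  note hD = sub_isoD[OF h] and h0 = sub_iso_zero[OF h d(1,2)]
  have c: "x \<in> carrier M" "h x \<in> carrier M" if "x \<in> X" for x
    using that hD(4) d(1,2) submod_carrier by auto
  define G where "G = (\<lambda>x. x \<oplus>\<^bsub>M\<^esub> h x) ` X"
  have G: "sm G"
  proof (rule submodI_smult)
    show "G \<subseteq> carrier M" unfolding G_def using c by auto
    show "\<zero>\<^bsub>M\<^esub> \<in> G" unfolding G_def using h0 submod_zero[OF d(1)] by (auto intro!: image_eqI[of _ _ "\<zero>\<^bsub>M\<^esub>"])
    fix u assume "u \<in> G"
    then obtain x where x: "x \<in> X" "u = x \<oplus>\<^bsub>M\<^esub> h x" unfolding G_def by blast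
    show "a \<odot>\<^bsub>M\<^esub> u \<in> G" if a: "a \<in> carrier R" for a
    proof -
      have "a \<odot>\<^bsub>M\<^esub> u = a \<odot>\<^bsub>M\<^esub> x \<oplus>\<^bsub>M\<^esub> h (a \<odot>\<^bsub>M\<^esub> x)"
        using x a hD(6) c smult_r_distr by simp
      then show ?thesis unfolding G_def using submod_smult[OF d(1) a x(1)] by blast
    qed
    fix v assume "v \<in> G"
    then obtain y where y: "y \<in> X" "v = y \<oplus>\<^bsub>M\<^esub> h y" unfolding G_def by blast
    have "u \<oplus>\<^bsub>M\<^esub> v = (x \<oplus>\<^bsub>M\<^esub> y) \<oplus>\<^bsub>M\<^esub> h (x \<oplus>\<^bsub>M\<^esub> y)"
      using x y c hD(5) by (simp add: M.a_ac)
    then show "u \<oplus>\<^bsub>M\<^esub> v \<in> G" unfolding G_def using submod_add[OF d(1) x(1) y(1)] by blast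
  qed
  have GZ: "G \<subseteq> Z" unfolding G_def d(4)[symmetric] using hD(4) mem_sumI by blast
  have zero: "x = \<zero>\<^bsub>M\<^esub>" if "x \<in> X" "h x = \<zero>\<^bsub>M\<^esub>" for x
    using that h0 inj_onD[OF hD(2) _ that(1) submod_zero[OF d(1)]] by simp
  have 1: "dsum X G Z"
  proof (rule dsumI[OF d(1) G])
    show "X \<boxplus> G = Z"
    proof (intro subset_antisym sum_least[OF d(3)] d(6) GZ)
      have "Y \<subseteq> X \<boxplus> G"
      proof
        fix y assume "y \<in> Y"
        then obtain x where x: "x \<in> X" "y = h x" using hD(3) by blast
        then have "y = \<ominus>\<^bsub>M\<^esub> x \<oplus>\<^bsub>M\<^esub> (x \<oplus>\<^bsub>M\<^esub> h x)" using c M.r_neg1 by simp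
        then show "y \<in> X \<boxplus> G" using mem_sumI[OF submod_neg[OF d(1) x(1)]] x(1) unfolding G_def by auto
      qed
      then show "Z \<subseteq> X \<boxplus> G"
        unfolding d(4)[symmetric] using sum_upper1[OF d(1) G] by (intro sum_least sm_sum d G)
    qed
    show "X \<inter> G \<subseteq> {\<zero>\<^bsub>M\<^esub>}"
    proof
      fix u assume "u \<in> X \<inter> G"
      then obtain x where x: "x \<in> X" "u = x \<oplus>\<^bsub>M\<^esub> h x" "u \<in> X" unfolding G_def by blast
      have "h x = \<ominus>\<^bsub>M\<^esub> x \<oplus>\<^bsub>M\<^esub> u" using x c M.r_neg1 by simp
      then have "h x \<in> X \<inter> Y" using submod_add[OF d(1) submod_neg[OF d(1) x(1)] x(3)] hD(4)[OF x(1)] by simp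
      then have "h x = \<zero>\<^bsub>M\<^esub>" using d(5) by blast
      then have "x = \<zero>\<^bsub>M\<^esub>" by (rule zero[OF x(1)])
      then show "u \<in> {\<zero>\<^bsub>M\<^esub>}" using x h0 by simp
    qed
  qed
  have 2: "dsum Y G Z"
  proof (rule dsumI[OF d(2) G])
    show "Y \<boxplus> G = Z"
    proof (intro subset_antisym sum_least[OF d(3)] d(7) GZ)
      have "X \<subseteq> Y \<boxplus> G"
      proof
        fix x assume x: "x \<in> X"
        have "x = \<ominus>\<^bsub>M\<^esub> h x \<oplus>\<^bsub>M\<^esub> (x \<oplus>\<^bsub>M\<^esub> h x)"
          using c[OF x] M.r_neg1[of "h x" x] M.a_comm[of x "h x"] by simp
        moreover have "x \<oplus>\<^bsub>M\<^esub> h x \<in> G" using x unfolding G_def by blast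
        ultimately show "x \<in> Y \<boxplus> G" using mem_sumI[OF submod_neg[OF d(2) hD(4)[OF x]]] by metis
      qed
      then show "Z \<subseteq> Y \<boxplus> G"
        unfolding d(4)[symmetric] using sum_upper1[OF d(2) G] by (intro sum_least sm_sum d G)
    qed
    show "Y \<inter> G \<subseteq> {\<zero>\<^bsub>M\<^esub>}"
    proof
      fix u assume "u \<in> Y \<inter> G"
      then obtain x where x: "x \<in> X" "u = x \<oplus>\<^bsub>M\<^esub> h x" "u \<in> Y" unfolding G_def by blast
      have "x = u \<ominus>\<^bsub>M\<^esub> h x" using x c by (simp add: a_minus_def M.a_assoc M.r_neg)
      moreover have "u \<ominus>\<^bsub>M\<^esub> h x \<in> Y" using submod_diff[OF d(2) x(3) hD(4)[OF x(1)]] .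
      ultimately have "x \<in> X \<inter> Y" using x(1) by simp
      then have "x = \<zero>\<^bsub>M\<^esub>" using d(5) by blast
      then show "u \<in> {\<zero>\<^bsub>M\<^esub>}" using x h0 by simp
    qed
  qed
  show thesis using that 1 2 by blast
qed

text \<open>More than an injective homomorphism: the image has to split off, which keeps complements
  available in the Schroeder-Bernstein argument.\<close>

definition embeds :: "'b set \<Rightarrow> 'b set \<Rightarrow> bool"  (infix "\<preceq>\<^sub>M" 50)
  where "X \<preceq>\<^sub>M Y \<longleftrightarrow> (\<exists>Y1 Y2. dsum Y1 Y2 Y \<and> X \<cong>\<^sub>M Y1)"

end

section \<open>The Schroeder-Bernstein theorem for summands up to isomorphism\<close>

context quasi_discrete_module
begin

text \<open>The shift \<open>f\<close> identifies \<open>X2 \<boxplus> U\<close> with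
  \<open>U\<close>, where \<open>U\<close> is the union of the stages \<open>V n\<close>. If
  \<open>U\<close> has a complement \<open>Z\<close> in \<open>X1\<close>, adding \<open>Z\<close>
  to both sides makes \<open>X\<close> isomorphic to \<open>X1\<close>, which is a copy of
  \<open>Y\<close>. That complement exists by \<open>summand_Union_chain\<close>.\<close>

theorem schroeder_bernstein:
  assumes "summand X" "summand Y" "X \<preceq>\<^sub>M Y" "Y \<preceq>\<^sub>M X"
  shows "X \<cong>\<^sub>M Y"
proof -
  obtain Y1 Y2 h where Y: "dsum Y1 Y2 Y" and h: "h \<in> sub_iso X Y1"
    using assms(3) unfolding embeds_def by (metis isomorphicE)
  obtain X1 X2 k where X: "dsum X1 X2 X" and k: "k \<in> sub_iso Y X1"
    using assms(4) unfolding embeds_def by (metis isomorphicE)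
  note x = dsumD[OF X] and y = dsumD[OF Y]
  obtain Xc where Xc: "dsum X Xc (carrier M)" using assms(1) summandE by blast
  have kY: "dsum (k ` Y1) (k ` Y2) X1"
    using sub_iso_dsum[OF k y(3) x(1) Y order.refl] sub_isoD(3)[OF k] by simp
  define f where "f = k \<circ> h"
  have f: "f \<in> sub_iso X (k ` Y1)"
    unfolding f_def using sub_iso_comp[OF h sub_iso_restrict[OF k y(6)]] .
  note f' = f x(3) dsumD(1)[OF kY]
  \<comment> \<open>\<open>V n\<close> is the sum of the images of \<open>X2\<close> under \<open>f\<close>, its square, and so on up to the \<open>n\<close>-th power\<close>
  define V where "V = rec_nat {\<zero>\<^bsub>M\<^esub>} (\<lambda>_ W. f ` (X2 \<boxplus> W))"
  have V0: "V 0 = {\<zero>\<^bsub>M\<^esub>}" and VS: "V (Suc n) = f ` (X2 \<boxplus> V n)" for n by (simp_all add: V_def)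
  have V: "\<exists>W. dsum (V n) W X1" for n
  proof (induction n)
    case 0
    then show ?case unfolding V0 using dsum_comm[OF dsum_zero[OF x(1)]] by blast
  next
    case (Suc n)
    then obtain W where W: "dsum (V n) W X1" by blast
    \<comment> \<open>\<open>f\<close> carries this decomposition of \<open>X\<close> to one of its
      image, which is itself a summand of \<open>X1\<close>.\<close>
    have "dsum (X2 \<boxplus> V n) W X" using dsum_assoc'[OF dsum_comm[OF X] W] by blast
    then have "dsum (V (Suc n)) (f ` W) (k ` Y1)"
      unfolding VS using sub_iso_dsum[OF f' _ order.refl] sub_isoD(3)[OF f] by metis
    then show ?case using dsum_assoc[OF _ kY] by blast
  qed
  have VX: "V n \<subseteq> X1" "sm (V n)" for n using V[of n] dsumD by blast+
  have V_mono: "V n \<subseteq> V (Suc n)" for n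
  proof (induction n)
    case 0
    then show ?case unfolding V0 using submod_zero[OF VX(2)[of "Suc 0"]] by simp
  next
    case (Suc n)
    then show ?case unfolding VS[of "Suc n"] VS[of n] using sum_mono image_mono by blast
  qed
  have "summand (V n)" for n
  proof -
    obtain W where "dsum (V n) W X1" using V by blast
    then show ?thesis using dsum_assoc[OF _ dsum_assoc(2)[OF X Xc]] dsum_assoc X Xc summandI by metis
  qed
  then have "summand (\<Union>n. V n)" using V_mono summand_Union_chain by blast
  then obtain L where L: "dsum (\<Union>n. V n) L (carrier M)" using summandE by blast
  define U where "U = (\<Union>n. V n)"
  define Z where "Z = X1 \<inter> L"
  have UZ: "dsum U Z X1"
    unfolding Z_def using L VX(1) x(1) submod_sub by (intro dsum_restrict[of _ _ "carrier M"]) (auto simp: U_def)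
  \<comment> \<open>Adding \<open>X2\<close> and then applying \<open>f\<close> moves each stage to
    the next, so the union is fixed.\<close>
  have fU: "f ` (X2 \<boxplus> U) = U"
  proof -
    have "X2 \<boxplus> U = (\<Union>n. X2 \<boxplus> V n)"
      unfolding U_def by (auto elim!: mem_sumE intro: mem_sumI)
    then have "f ` (X2 \<boxplus> U) = (\<Union>n. V (Suc n))" unfolding VS by auto
    also have "\<dots> = U" unfolding U_def using V_mono by (intro subset_antisym) blast+
    finally show ?thesis .
  qed
  have XU: "dsum (X2 \<boxplus> U) Z X" using dsum_assoc'[OF dsum_comm[OF X] UZ] by blast
  have "X2 \<boxplus> U \<cong>\<^sub>M U" using isomorphicI[OF sub_iso_restrict[OF f dsumD(6)[OF XU]]] fU by simp
  then have "X \<cong>\<^sub>M X1" using isomorphic_dsum[OF XU UZ] isomorphic_refl by blast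
  moreover have "X1 \<cong>\<^sub>M Y" using isomorphic_sym[OF isomorphicI[OF k] y(3)] .
  ultimately show ?thesis using isomorphic_trans by blast
qed

section \<open>Good positions of summands linked by perspectivities\<close>

text \<open>
  First \<open>A\<close> and \<open>B'\<close> are put in good position, which gives \<open>A \<approx> I' \<oplus> A'\<close> and \<open>B' = I' \<oplus> B1\<close> with
  \<open>A' \<cong> B1\<close> because of the common complement; then \<open>A'\<close> and \<open>B\<close>.
\<close>

lemma perspective_good_position:
  assumes "summand A" "summand B" and AC: "dsum A C (carrier M)" and B'C: "dsum B' C (carrier M)"
    and B': "dsum B' B'' B"
  obtains I A1 Y Q where "dsums [I, A1, Y, Q] (carrier M)" "I \<boxplus> A1 \<approx> A" "dsum I Y B" "A1 \<preceq>\<^sub>M Y"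
proof -
  note sB = summand_sm[OF assms(2)]
  obtain I' A' B1 Q' where 1: "dsums [I', A', B1, Q'] (carrier M)" "I' \<boxplus> A' \<approx> A" "dsum I' B1 B'"
    using good_position[OF assms(1) summandI[OF B'C]] by blast
  note b' = dsumD[OF 1(3)]
  have I'A': "dsum I' A' (I' \<boxplus> A')" "summand (I' \<boxplus> A')"
    using 1(1) summandI unfolding dsums_Cons2 by blast+
  have A'c: "dsums [A', I', B1, Q'] (carrier M)" using dsums_swap 1(1) by blast
  note sA' = dsumD(2)[OF I'A'(1)]
  \<comment> \<open>The complement \<open>C\<close> of \<open>A\<close> also serves
    \<open>I' \<boxplus> A'\<close>. Hence \<open>A'\<close> and \<open>B1\<close> have the common
    complement \<open>I' \<boxplus> C\<close>.\<close>
  have "dsum (I' \<boxplus> A') C (carrier M)"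
    using dsum_eq_small eq_small_sym 1(2) I'A'(2) AC by blast
  then have "dsum A' (I' \<boxplus> C) (carrier M)"
    using dsum_assoc(2)[OF dsum_comm[OF I'A'(1)]] by blast
  moreover have "dsum B1 (I' \<boxplus> C) (carrier M)" using dsum_assoc(2)[OF dsum_comm[OF 1(3)] B'C] .
  ultimately have A'B1: "A' \<cong>\<^sub>M B1" using isomorphic_if_common_complement by blast
  obtain D where D: "dsum A' D (carrier M)" "dsums [I', B1, Q'] D"
    using A'c unfolding dsums.simps(2)[of A'] by blast
  \<comment> \<open>\<open>A'\<close> is independent of \<open>B'\<close> but may overlap with the
    rest of \<open>B\<close>. Up to small submodules \<open>J\<close> is this overlap, and
    \<open>A1\<close> is what remains.\<close>
  obtain J A1 B2 Q where 2: "dsums [J, A1, B2, Q] (carrier M)" "J \<boxplus> A1 \<approx> A'" "dsum J B2 B"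
    using good_position[OF summandI[OF D(1)] assms(2)] by blast
  have JA1: "dsum J A1 (J \<boxplus> A1)" "summand (J \<boxplus> A1)"
    using 2(1) summandI unfolding dsums_Cons2 by blast+
  have JA1D: "dsum (J \<boxplus> A1) D (carrier M)"
    using dsum_eq_small eq_small_sym 2(2) JA1(2) D(1) by blast
  \<comment> \<open>As \<open>D\<close> is a complement of \<open>J \<boxplus> A1\<close> too,
    \<open>J\<close> and \<open>A1\<close> can be put in place of \<open>A'\<close> in the first
    decomposition.\<close>
  have all: "dsums [J, A1, I', B1, Q'] (carrier M)"
    using JA1D D(2) JA1(1) unfolding dsums_Cons2[of J] by blast
  then have "dsums [I', J, B1, A1, Q'] (carrier M)" by (rule dsums_perm) simp
  then obtain V where V: "dsum I' J (I' \<boxplus> J)" "dsums [B1, A1, Q'] V" "dsum (I' \<boxplus> J) V (carrier M)"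
    unfolding dsums_Cons2[of I'] by blast
  obtain W where W: "dsum A1 Q' W" "dsum B1 W V"
    using V(2) unfolding dsums.simps(2)[of B1] dsums_2 by blast
  define I where "I = I' \<boxplus> J"
  note I'J = V(1)[folded I_def]
  have IB1: "dsum I B1 (I \<boxplus> B1)" "dsum (I \<boxplus> B1) W (carrier M)"
    using dsum_assoc'[OF V(3)[folded I_def] W(2)] by auto
  have "I' \<subseteq> B" "B1 \<subseteq> B" "J \<subseteq> B" using b'(6,7) dsumD(6)[OF B'] dsumD(6)[OF 2(3)] by auto
  then have "I \<boxplus> B1 \<subseteq> B" unfolding I_def using sB by (intro sum_least) auto
  then have BK: "dsum (I \<boxplus> B1) (B \<inter> W) B"
    using dsum_restrict[OF IB1(2) sB _ submod_sub[OF sB]] by blast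
  \<comment> \<open>This complement of \<open>I\<close> in \<open>B\<close> is chosen so as to have
    \<open>B1\<close> as a summand; the embedding of \<open>A1\<close> lands in
    \<open>B1\<close>.\<close>
  define Y where "Y = B1 \<boxplus> (B \<inter> W)"
  have Y: "dsum B1 (B \<inter> W) Y" "dsum I Y B" unfolding Y_def using dsum_assoc[OF IB1(1) BK] by auto
  have "dsums [J, B2, A1, Q] (carrier M)" using 2(1) by (rule dsums_perm) simp
  \<comment> \<open>Both \<open>I \<boxplus> Y\<close> and \<open>J \<boxplus> B2\<close> are direct
    sums equal to \<open>B\<close>, so one pair replaces the other in the second
    decomposition.\<close>
  then have "dsums [I, Y, A1, Q] (carrier M)"
    using dsumD(4)[OF 2(3)] dsumD(4)[OF Y(2)] Y(2) unfolding dsums_Cons2 by auto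
  then have r1: "dsums [I, A1, Y, Q] (carrier M)" by (rule dsums_perm) simp
  have s: "sm I'" "sm J" "sm A1" "sm (J \<boxplus> A1)" "sm (I' \<boxplus> A')" "sm I" "sm A"
    using I'J JA1(1) I'A'(1) AC dsumD by blast+
  have "I \<boxplus> A1 = I' \<boxplus> (J \<boxplus> A1)" unfolding I_def using s sum_assoc by blast
  also have "\<dots> \<approx> I' \<boxplus> A'" using eq_small_sum[OF eq_small_refl 2(2)] s sA' by blast
  finally have r2: "I \<boxplus> A1 \<approx> A" using eq_small_trans[OF _ 1(2)] s sm_sum by blast
  \<comment> \<open>\<open>J \<boxplus> A1\<close> and \<open>A'\<close> share the complement
    \<open>D\<close>, and \<open>A'\<close> is isomorphic to \<open>B1\<close>. The image of
    \<open>A1\<close> is then a summand of \<open>B1\<close>, hence of \<open>Y\<close>.\<close>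
  have "J \<boxplus> A1 \<cong>\<^sub>M B1"
    using isomorphic_if_common_complement[OF JA1D D(1)] A'B1 isomorphic_trans by blast
  then obtain h where h: "h \<in> sub_iso (J \<boxplus> A1) B1" by (rule isomorphicE)
  have "dsum (h ` A1) (h ` J) B1"
    using sub_iso_dsum[OF h s(4) dsumD(1)[OF Y(1)] dsum_comm[OF JA1(1)]] sub_isoD(3)[OF h] by simp
  then have "dsum (h ` A1) (h ` J \<boxplus> (B \<inter> W)) Y" using dsum_assoc(2) Y(1) by blast
  moreover have "A1 \<cong>\<^sub>M h ` A1" using isomorphicI sub_iso_restrict[OF h] dsumD(7)[OF JA1(1)] by blast
  ultimately have "A1 \<preceq>\<^sub>M Y" unfolding embeds_def by blast
  with r1 r2 Y(2) show thesis using that by blast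
qed

text \<open>Of the two parts of \<open>B\<close>, \<open>A\<close> absorbs \<open>I\<close> up to a
  small submodule.\<close>

lemma sum_eq_small:
  assumes "dsum I Y B" "I \<lesssim> A" "sm A"
  shows "A \<boxplus> B \<approx> A \<boxplus> Y"
proof -
  note d = dsumD[OF assms(1)]
  have s: "sm (A \<boxplus> Y)" "sm (A \<boxplus> B)" using assms(3) d sm_sum by auto
  have le: "A \<lesssim> A \<boxplus> Y" "Y \<lesssim> A \<boxplus> Y"
    using s subset_le_small sum_upper1[OF assms(3) d(2)] sum_upper2[OF assms(3) d(2)] by auto
  then have "I \<boxplus> Y \<lesssim> A \<boxplus> Y" using le_small_sum le_small_trans assms(2) s by blast
  then have "A \<boxplus> B \<lesssim> A \<boxplus> Y" using d(4) le_small_sum le s by blast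
  moreover have "A \<boxplus> Y \<lesssim> A \<boxplus> B" using sum_mono[OF order.refl d(7)] subset_le_small s by blast
  ultimately show ?thesis unfolding eq_small_def by blast
qed

text \<open>\<open>B + A1\<close> and \<open>B + Z\<close> are both summands approximating \<open>A + B\<close>, so \<open>A1\<close> and \<open>Z\<close> have a common
  complement.\<close>

lemma good_position_unique:
  assumes 1: "dsums [I, A1, Y, Q] (carrier M)" "I \<boxplus> A1 \<approx> A" "dsum I Y B" "summand A"
    and 2: "dsums [I', B1, Z, Q'] (carrier M)" "I' \<boxplus> B1 \<approx> B" "dsum I' Z A" "summand B"
  shows "A1 \<cong>\<^sub>M Z"
proof -
  have s: "sm A" "sm B" using 1 2 summand_sm by auto
  have "dsums [I, Y, A1, Q] (carrier M)" using 1(1) by (rule dsums_perm) simp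
  then obtain V where V: "dsum A1 Q V" "dsum B V (carrier M)"
    using dsumD(4)[OF 1(3)] unfolding dsums_Cons2[of I] dsums_2 by auto
  obtain W where W: "dsum I' B1 (I' \<boxplus> B1)" "dsum Z Q' W" "dsum (I' \<boxplus> B1) W (carrier M)"
    using 2(1) unfolding dsums_Cons2[of I'] dsums_2 by auto
  \<comment> \<open>\<open>W\<close> passes from \<open>I' \<boxplus> B1\<close> to \<open>B\<close>
    as a complement. As \<open>Z\<close> is a summand of \<open>W\<close>, the sum of
    \<open>B\<close> and \<open>Z\<close> is direct and has the complement
    \<open>Q'\<close>.\<close>
  have BW: "dsum B W (carrier M)" using dsum_eq_small[OF 2(2,4)] W(3) by blast
  have IA1: "dsum I A1 (I \<boxplus> A1)" using 1(1) unfolding dsums_Cons2[of I] by blast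
  note BA1 = dsum_assoc'[OF V(2,1)] and BZ = dsum_assoc'[OF BW W(2)]
  have "I \<lesssim> A" "I' \<lesssim> B"
    using 1(2) 2(2) dsumD(3,6)[OF IA1] dsumD(3,6)[OF W(1)] s le_small_trans subset_le_small
    unfolding eq_small_def by blast+
  then have AB: "A \<boxplus> B \<approx> A \<boxplus> Y" "B \<boxplus> A \<approx> B \<boxplus> Z"
    using sum_eq_small 1(3) 2(3) s by auto
  have si: "sm I" "sm A1" "sm Y" "sm Z" using 1(3) 2(3) V(1) dsumD by blast+
  \<comment> \<open>Regrouping gives \<open>(I \<boxplus> A1) \<boxplus> Y\<close>, which
    approximates \<open>A \<boxplus> Y\<close>, hence \<open>A \<boxplus> B\<close>, hence
    \<open>B \<boxplus> Z\<close>.\<close>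
  have "B \<boxplus> A1 = (I \<boxplus> A1) \<boxplus> Y"
    unfolding dsumD(4)[OF 1(3), symmetric] using si sum_assoc sum_comm by metis
  moreover have "(I \<boxplus> A1) \<boxplus> Y \<approx> A \<boxplus> Y" using eq_small_sum[OF 1(2) eq_small_refl] si s sm_sum by blast
  ultimately have "B \<boxplus> A1 \<approx> A \<boxplus> Y" by simp
  then have "B \<boxplus> A1 \<approx> B \<boxplus> Z"
    using AB eq_small_sym eq_small_trans sum_comm[OF s] sm_sum si s by metis
  \<comment> \<open>The complement \<open>Q\<close> passes from \<open>B \<boxplus> A1\<close> to
    \<open>B \<boxplus> Z\<close>, which makes \<open>B \<boxplus> Q\<close> a common complement of
    \<open>A1\<close> and \<open>Z\<close>.\<close>
  then have "dsum (B \<boxplus> Z) Q (carrier M)"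
    using dsum_eq_small summandI[OF BZ(2)] BA1(2) by blast
  then have "dsum Z (B \<boxplus> Q) (carrier M)" using dsum_assoc(2) dsum_comm[OF BZ(1)] by blast
  moreover have "dsum A1 (B \<boxplus> Q) (carrier M)" using dsum_assoc(2) dsum_comm[OF BA1(1)] BA1(2) by blast
  ultimately show ?thesis using isomorphic_if_common_complement by blast
qed

section \<open>The Schroeder-Bernstein theorem for perspectivity\<close>

lemma perspective_iff: "perspective R M A B \<longleftrightarrow> (\<exists>C. dsum A C (carrier M) \<and> dsum B C (carrier M))"
  unfolding perspective_def direct_sum_iff ..

theorem perspective_schroeder_bernstein:
  assumes A: "summand A" and B: "summand B"
    and B': "dsum B' B'' B" "perspective R M A B'" and A': "dsum A' A'' A" "perspective R M B A'"
  shows "perspective R M A B"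
proof -
  obtain C where C: "dsum A C (carrier M)" "dsum B' C (carrier M)"
    using B'(2) unfolding perspective_iff by blast
  obtain D where D: "dsum B D (carrier M)" "dsum A' D (carrier M)"
    using A'(2) unfolding perspective_iff by blast
  obtain I A1 Y Q where 1: "dsums [I, A1, Y, Q] (carrier M)" "I \<boxplus> A1 \<approx> A" "dsum I Y B"
    and AY: "A1 \<preceq>\<^sub>M Y" using perspective_good_position[OF A B C B'(1)] by blast
  obtain I' B1 Z Q' where 2: "dsums [I', B1, Z, Q'] (carrier M)" "I' \<boxplus> B1 \<approx> B" "dsum I' Z A"
    and BZ: "B1 \<preceq>\<^sub>M Z" using perspective_good_position[OF B A D A'(1)] by blast
  \<comment> \<open>The good positions of \<open>A\<close> against \<open>B\<close> and of
    \<open>B\<close> against \<open>A\<close> are compared. They turn the embeddings of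
    \<open>A1\<close> in \<open>Y\<close> and of \<open>B1\<close> in \<open>Z\<close> into
    embeddings of \<open>Z\<close> and \<open>Y\<close> in each other.\<close>
  have A1Z: "A1 \<cong>\<^sub>M Z" using good_position_unique[OF 1 A 2 B] .
  have B1Y: "B1 \<cong>\<^sub>M Y" using good_position_unique[OF 2 B 1 A] .
  have "sm A1" "sm B1"
    using 1(1) 2(1) dsumD(2) unfolding dsums_Cons2[of I] dsums_Cons2[of I'] by blast+
  then have "Z \<preceq>\<^sub>M Y" "Y \<preceq>\<^sub>M Z"
    using AY BZ isomorphic_sym[OF A1Z] isomorphic_sym[OF B1Y] isomorphic_trans
    unfolding embeds_def by blast+
  moreover have "summand Y" "summand Z"
    using dsum_assoc(2) dsum_comm summandI 1(3) 2(3) A B summandE by metis+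
  ultimately have "Z \<cong>\<^sub>M Y" using schroeder_bernstein by blast
  then have "A1 \<cong>\<^sub>M Y" using A1Z isomorphic_trans by blast
  have "dsums [A1, Y, I, Q] (carrier M)" using 1(1) by (rule dsums_perm) simp
  then obtain W where W: "dsum I Q W" "dsum A1 Y (A1 \<boxplus> Y)" "dsum (A1 \<boxplus> Y) W (carrier M)"
    unfolding dsums_Cons2[of A1] dsums_2 by blast
  obtain G where G: "dsum A1 G (A1 \<boxplus> Y)" "dsum Y G (A1 \<boxplus> Y)"
    using graph_complement[OF W(2) \<open>A1 \<cong>\<^sub>M Y\<close>] .
  \<comment> \<open>For \<open>X\<close> equal to \<open>A1\<close> and to \<open>Y\<close>: the
    same \<open>G \<boxplus> Q\<close> is a complement of \<open>I \<boxplus> A1\<close>, which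
    approximates \<open>A\<close>, and of \<open>I \<boxplus> Y\<close>, which is
    \<open>B\<close>.\<close>
  have *: "dsum (I \<boxplus> X) (G \<boxplus> Q) (carrier M)" if "dsum X G (A1 \<boxplus> Y)" for X
  proof -
    have "dsums [X, G, I, Q] (carrier M)"
      using that dsumD(4)[OF that] W(1,3) unfolding dsums_Cons2[of X] dsums_2 by auto
    then have "dsums [I, X, G, Q] (carrier M)" by (rule dsums_perm) simp
    then obtain V where "dsum G Q V" "dsum (I \<boxplus> X) V (carrier M)"
      unfolding dsums_Cons2[of I] dsums_2 by blast
    then show ?thesis using dsumD(4)[of G Q V] by simp
  qed
  have "dsum (I \<boxplus> A1) (G \<boxplus> Q) (carrier M)" "dsum B (G \<boxplus> Q) (carrier M)"
    using *[OF G(1)] *[OF G(2)] dsumD(4)[OF 1(3)] by simp_all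
  then show ?thesis unfolding perspective_iff using dsum_eq_small[OF 1(2) A] by blast
qed

end

text \<open>\<open>PSB_property\<close> treats \<open>A\<close> and \<open>B\<close> as modules in
  their own right. Replacing the carrier leaves the operations unchanged, so submodules of
  \<open>B\<close> are submodules of \<open>M\<close> and their sums agree.\<close>

lemma (in left_module) direct_summand_submoduleE:
  assumes "sm B" "direct_summand R (M\<lparr>carrier := B\<rparr>) X"
  obtains Y where "dsum X Y B"
proof -
  let ?N = "M\<lparr>carrier := B\<rparr>"
  obtain Y where Y: "submodule X R ?N" "submodule Y R ?N" "X <+>\<^bsub>?N\<^esub> Y = B" "X \<inter> Y = {\<zero>\<^bsub>M\<^esub>}"
    using assms(2) unfolding direct_summand_def direct_sum_def by auto
  have sm: "sm H" if H: "submodule H R ?N" for H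
  proof (rule submodI_smult)
    note g = submodule.axioms(1)[OF H]
    show "H \<subseteq> carrier M" using subgroup.subset[OF g] submod_sub[OF assms(1)] by simp
    show "\<zero>\<^bsub>M\<^esub> \<in> H" using subgroup.one_closed[OF g] by simp
    show "x \<oplus>\<^bsub>M\<^esub> y \<in> H" if "x \<in> H" "y \<in> H" for x y using subgroup.m_closed[OF g that] by simp
    show "a \<odot>\<^bsub>M\<^esub> x \<in> H" if "a \<in> carrier R" "x \<in> H" for a x
      using submodule.smult_closed[OF H that] by simp
  qed
  have "X <+>\<^bsub>?N\<^esub> Y = X \<boxplus> Y" unfolding set_add_def set_mult_def by simp
  then have "dsum X Y B" using Y sm by (intro dsumI) simp_all
  then show thesis by (rule that)
qed

theorem theorem2p9:
  fixes R :: "('a, 'r) ring_scheme" and M :: "('a, 'b, 'm) module_scheme"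
  assumes "left_module R M"
    and "quasi_discrete R M"
    and "finite_exchange TYPE(nat \<Rightarrow> 'b) R M"
  shows "PSB_property R M"
proof -
  interpret quasi_discrete_module R M
    using assms(1,2) by (intro quasi_discrete_module.intro quasi_discrete_module_axioms.intro)
  show ?thesis
    unfolding PSB_property_def
  proof (intro allI impI, elim conjE exE)
    fix A B A' B'
    assume A: "direct_summand R M A" and B: "direct_summand R M B"
      and A': "direct_summand R (M\<lparr>carrier := A\<rparr>) A'" "perspective R M B A'"
      and B': "direct_summand R (M\<lparr>carrier := B\<rparr>) B'" "perspective R M A B'"
    obtain A'' where "dsum A' A'' A" using direct_summand_submoduleE[OF summand_sm[OF A] A'(1)] .
    moreover obtain B'' where "dsum B' B'' B" using direct_summand_submoduleE[OF summand_sm[OF B] B'(1)] .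
    ultimately show "perspective R M A B"
      using perspective_schroeder_bernstein A B A'(2) B'(2) by blast
  qed
qed

end
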